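(* Let $(X,\mu)$ be a standard probability space and let $\mathcal{G}$ be an ergodic $d$-regular Borel pmp graph on $X$ with spectral gap. If $-d\in\sigma(T_{\mathcal{G}})$, then $\mathcal{G}$ is approximately measurably bipartite.
   Context: A Borel graph on $X$ is a simple undirected graph whose edge set is Borel in $X^2$; it is $d$-regular if every vertex has degree $d$ (up to a null set). $\mathcal{G}$ is pmp if every partial Borel bijection of $X$ whose graph is contained in the connectedness relation of $\mathcal{G}$ preserves $\mu$. $\mathcal{G}$ is ergodic if every measurable set that is a union of connected components of $\mathcal{G}$ has measure $0$ or $1$. The adjacency operator is $(T_{\mathcal{G}}f)(x)=\sum_{y\sim x}f(y)$ on $L^2(X,\mu)$; $\sigma$ denotes spectrum. A $d$-regular $\mathcal{G}$ has spectral gap if there is $\varepsilon>0$ with $\sigma(T_{\mathcal{G}})\subseteq[-d,d-\varepsilon]\cup\{d\}$. $\mathcal{G}$ is approximately measurably bipartite if for every $\varepsilon>0$ there are disjoint measurable sets $A,B$, each containing no two adjacent vertices, with $\mu(A\cup B)>1-\varepsilon$. *)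

theory Defs
  imports "HOL-Probability.Probability"
begin

text \<open>A standard probability space: a probability measure on the Borel sets of a Polish space
  (every standard Borel space is Borel-isomorphic to such a one).\<close>
definition standard_prob_space :: "'a::polish_space measure \<Rightarrow> bool" where
  "standard_prob_space M \<longleftrightarrow> prob_space M \<and> sets M = sets borel"

definition borel_graph :: "'a measure \<Rightarrow> ('a \<Rightarrow> 'a \<Rightarrow> bool) \<Rightarrow> bool" where
  "borel_graph M E \<longleftrightarrow> (\<forall>x y. E x y \<longrightarrow> E y x) \<and> (\<forall>x. \<not> E x x)
     \<and> {(x, y). E x y} \<in> sets (M \<Otimes>\<^sub>M M)"

definition neighbours :: "('a \<Rightarrow> 'a \<Rightarrow> bool) \<Rightarrow> 'a \<Rightarrow> 'a set" where
  "neighbours E x = {y. E x y}"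

definition regular_graph :: "'a measure \<Rightarrow> ('a \<Rightarrow> 'a \<Rightarrow> bool) \<Rightarrow> nat \<Rightarrow> bool" where
  "regular_graph M E d \<longleftrightarrow> (AE x in M. finite (neighbours E x) \<and> card (neighbours E x) = d)"

abbreviation connected_rel :: "('a \<Rightarrow> 'a \<Rightarrow> bool) \<Rightarrow> 'a \<Rightarrow> 'a \<Rightarrow> bool" where
  "connected_rel E \<equiv> E\<^sup>*\<^sup>*"

definition partial_borel_bijection :: "'a measure \<Rightarrow> 'a set \<Rightarrow> ('a \<Rightarrow> 'a) \<Rightarrow> bool" where
  "partial_borel_bijection M A f \<longleftrightarrow> A \<in> sets M \<and> inj_on f A \<and> f ` A \<subseteq> space M
     \<and> (\<forall>C \<in> sets M. f -` C \<inter> A \<in> sets M)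
     \<and> (\<forall>B \<in> sets M. B \<subseteq> A \<longrightarrow> f ` B \<in> sets M)"

definition pmp_graph :: "'a measure \<Rightarrow> ('a \<Rightarrow> 'a \<Rightarrow> bool) \<Rightarrow> bool" where
  "pmp_graph M E \<longleftrightarrow> (\<forall>A f. partial_borel_bijection M A f \<and> (\<forall>x\<in>A. connected_rel E x (f x))
     \<longrightarrow> (\<forall>B \<in> sets M. B \<subseteq> A \<longrightarrow> emeasure M (f ` B) = emeasure M B))"

definition ergodic_graph :: "'a measure \<Rightarrow> ('a \<Rightarrow> 'a \<Rightarrow> bool) \<Rightarrow> bool" where
  "ergodic_graph M E \<longleftrightarrow> (\<forall>S \<in> sets M. (\<forall>x y. x \<in> S \<and> connected_rel E x y \<longrightarrow> y \<in> S)
     \<longrightarrow> measure M S = 0 \<or> measure M S = 1)"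

definition L2 :: "'a measure \<Rightarrow> ('a \<Rightarrow> complex) set" where
  "L2 M = {f. f \<in> borel_measurable M \<and> integrable M (\<lambda>x. (cmod (f x))\<^sup>2)}"

definition adjacency_op :: "('a \<Rightarrow> 'a \<Rightarrow> bool) \<Rightarrow> ('a \<Rightarrow> complex) \<Rightarrow> 'a \<Rightarrow> complex" where
  "adjacency_op E f x = (\<Sum>y\<in>neighbours E x. f y)"

text \<open>Spectrum of the adjacency operator on L^2(X,mu): those lambda for which
  T - lambda I is not a bijection of L^2 (functions identified up to a.e. equality).
  Boundedness of the inverse is automatic (T is bounded; bounded inverse theorem).\<close>
definition adjacency_spectrum :: "'a measure \<Rightarrow> ('a \<Rightarrow> 'a \<Rightarrow> bool) \<Rightarrow> complex set" where
  "adjacency_spectrum M E = {lam.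
     \<not> ((\<forall>g \<in> L2 M. \<exists>f \<in> L2 M. AE x in M. adjacency_op E f x - lam * f x = g x)
       \<and> (\<forall>f \<in> L2 M. (AE x in M. adjacency_op E f x - lam * f x = 0) \<longrightarrow> (AE x in M. f x = 0)))}"

definition has_spectral_gap :: "'a measure \<Rightarrow> ('a \<Rightarrow> 'a \<Rightarrow> bool) \<Rightarrow> nat \<Rightarrow> bool" where
  "has_spectral_gap M E d \<longleftrightarrow> (\<exists>eps>0. adjacency_spectrum M E \<subseteq>
     {complex_of_real t | t. - real d \<le> t \<and> t \<le> real d - eps} \<union> {complex_of_real (real d)})"

definition independent_set :: "('a \<Rightarrow> 'a \<Rightarrow> bool) \<Rightarrow> 'a set \<Rightarrow> bool" where
  "independent_set E A \<longleftrightarrow> (\<forall>x\<in>A. \<forall>y\<in>A. \<not> E x y)"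

definition approx_measurably_bipartite :: "'a measure \<Rightarrow> ('a \<Rightarrow> 'a \<Rightarrow> bool) \<Rightarrow> bool" where
  "approx_measurably_bipartite M E \<longleftrightarrow> (\<forall>eps>0. \<exists>A B. A \<in> sets M \<and> B \<in> sets M \<and> A \<inter> B = {}
     \<and> independent_set E A \<and> independent_set E B \<and> measure M (A \<union> B) > 1 - eps)"

end

theory Submission
  imports Defs "HOL-Library.Function_Algebras"
begin

text \<open>
  Write \<open>T\<close> for the adjacency operator. Since \<open>-d\<close> is in the spectrum of the self-adjoint operator
  \<open>T\<close> and \<open>T + d \<ge> 0\<close>, there are unit vectors \<open>f\<close> with \<open>\<langle>(T + d) f, f\<rangle>\<close>, hence the integral of
  \<open>\<Sum>y\<sim>x. (f(x) + f(y))\<^sup>2\<close>, arbitrarily small. Then \<open>\<bar>f\<bar>\<close> has small energy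
  \<open>\<langle>(d - T) \<bar>f\<bar>, \<bar>f\<bar>\<rangle>\<close>. By the spectral gap and ergodicity the energy controls the variance, so
  \<open>\<bar>f\<bar>\<close> is close to a constant and \<open>{f > 1/2}\<close>, \<open>{f < -1/2}\<close> cover almost everything; few points
  have a neighbour in their own class, and deleting them leaves independent sets.

  Two points need care. Measurability of sums over neighbours and the mass transport principle rest
  on Lusin separation of analytic sets. And that a null set has a null set of neighbours is taken
  from the spectral hypothesis, because vertices in the exceptional null set of \<open>regular_graph\<close> may
  have uncountably many neighbours.
\<close>

section \<open>Analytic sets and sums over neighbours\<close>

text \<open>\<open>adjacency_spectrum\<close> only speaks of solving \<open>T f - t f = g\<close>
  almost everywhere, so spectral calculus is replaced by estimates on quadratic forms. That
  \<open>-d\<close> in the spectrum gives vectors nearly minimising \<open>d + T\<close> is the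
  contrapositive of a Neumann series. For \<open>S = d - T\<close> the gap says that
  \<open>S - \<mu>\<close> is onto for \<open>0 < \<mu> < \<epsilon>\<close>. This forces
  \<open>\<epsilon> * ip (S f) f \<le> ip (S f) (S f)\<close>, and under that inequality the
  iterates of \<open>1 - S/c\<close> converge to a projection onto the kernel of \<open>S\<close>,
  with an error bounded by the energy. Ergodicity identifies the kernel with the constants.

  Passing from \<open>f\<close> to its absolute value does not increase the energy, because
  \<open>\<bar>\<bar>a\<bar> - \<bar>b\<bar>\<bar> \<le> \<bar>a + b\<bar>\<close>. The mean
  \<open>m\<close> of the absolute value satisfies \<open>m\<^sup>2 = 1 - variance\<close>, so it is
  close to 1. The threshold 1/2 then serves twice: few points have
  \<open>\<bar>f x\<bar> \<le> 1/2\<close>, and an edge inside one class has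
  \<open>\<bar>f x + f y\<bar> > 1\<close>, which Markov's inequality makes rare.\<close>

definition analytic :: "'a::topological_space set \<Rightarrow> bool" where
  "analytic S \<longleftrightarrow> (\<exists>C f. closed (C :: (nat \<Rightarrow> nat) set) \<and> continuous_on C f \<and> S = f ` C)"

lemma analytic_image:
  assumes "analytic S" "continuous_on S g" shows "analytic (g ` S)"
proof -
  obtain C f where "closed (C :: (nat \<Rightarrow> nat) set)" "continuous_on C f" "S = f ` C"
    using assms(1) by (auto simp: analytic_def)
  then show ?thesis using assms(2) unfolding analytic_def
    by (intro exI[of _ C] exI[of _ "g \<circ> f"]) (auto simp: image_comp intro: continuous_on_compose2)
qed

section \<open>Topology of the Baire space\<close>

lemma tendsto_fun_iff:
  fixes f :: "'b \<Rightarrow> 'i \<Rightarrow> 'a::topological_space"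
  shows "(f \<longlongrightarrow> l) F \<longleftrightarrow> (\<forall>i. ((\<lambda>c. f c i) \<longlongrightarrow> l i) F)"
  using limitin_componentwise[of "\<lambda>i::'i. euclidean :: 'a topology" UNIV f l F]
  by (simp add: euclidean_product_topology)

text \<open>The centre is a full sequence although only its first \<open>n\<close> entries count:
  extending a prefix by one entry is then a function update.\<close>

definition cyl :: "nat \<Rightarrow> (nat \<Rightarrow> nat) \<Rightarrow> (nat \<Rightarrow> nat) set" where
  "cyl n a = {s. \<forall>i<n. s i = a i}"

lemma tendsto_cyl:
  assumes "\<And>n. s n \<in> cyl n a" shows "s \<longlonglongrightarrow> a"
  unfolding tendsto_fun_iff
proof
  fix i
  have "eventually (\<lambda>n. s n i = a i) sequentially"
    using eventually_gt_at_top[of i] by eventually_elim (use assms in \<open>auto simp: cyl_def\<close>)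
  then show "(\<lambda>n. s n i) \<longlonglongrightarrow> a i" by (rule tendsto_eventually)
qed

lemma open_cyl_subset:
  assumes "open U" "a \<in> U" obtains n where "cyl n a \<subseteq> U"
proof (rule ccontr)
  assume "\<not> thesis"
  then have "\<forall>n. \<exists>s. s \<in> cyl n a \<and> s \<notin> U" using that by auto
  then obtain s where s: "\<And>n. s n \<in> cyl n a" "\<And>n. s n \<notin> U" by metis
  have "eventually (\<lambda>n. s n \<in> U) sequentially"
    using tendsto_cyl[OF s(1)] assms by (rule topological_tendstoD)
  then show False using s(2) by simp
qed

lemma open_cyl: "open (cyl n a)"
proof -
  have "cyl n a = (\<Inter>i\<in>{..<n}. (\<lambda>s. s i) -` {a i})" by (auto simp: cyl_def)
  moreover have "open ((\<lambda>s::nat\<Rightarrow>nat. s i) -` {a i})" for i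
    by (rule open_vimage[OF _ continuous_on_product_coordinates]) (rule discrete_topology_class.open_discrete)
  ultimately show ?thesis by (auto intro!: open_INT)
qed

text \<open>A point of the Baire space names the limit of a fast Cauchy sequence in a dense sequence.\<close>
lemma polish_Baire_image:
  obtains C :: "(nat \<Rightarrow> nat) set" and f :: "(nat \<Rightarrow> nat) \<Rightarrow> 'a::polish_space"
  where "closed C" "continuous_on C f" "f ` C = UNIV"
proof -
  obtain D :: "'a set" where D: "countable D" "\<And>X. open X \<Longrightarrow> X \<noteq> {} \<Longrightarrow> \<exists>d\<in>D. d \<in> X"
    by (rule countable_dense_setE) blast
  have "D \<noteq> {}" using D(2)[of UNIV] by auto
  define q where "q = from_nat_into D"
  have q: "\<exists>n. dist (q n) x < e" if "e > 0" for x e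
  proof -
    have "ball x e \<noteq> {}" using that by auto
    then obtain d where "d \<in> D" "d \<in> ball x e" using D(2)[of "ball x e"] by blast
    moreover obtain n where "q n = d"
      using \<open>d \<in> D\<close> D(1) by (metis from_nat_into_surj q_def)
    ultimately show ?thesis by (auto simp: dist_commute)
  qed
  \<comment> \<open>Prescribing the rate of convergence makes \<open>C\<close> closed, since each
    condition involves only two coordinates, and bounds the error after entry \<open>n\<close> by
    \<open>(1/2)^n\<close>, which yields continuity of the limit map.\<close>
  define C where "C = {s. \<forall>m n. m \<le> n \<longrightarrow> dist (q (s m)) (q (s n)) \<le> (1/2)^m}"
  have cq: "continuous_on UNIV (\<lambda>s::nat\<Rightarrow>nat. q (s m))" for m
    by (rule continuous_on_compose2[of UNIV q UNIV "\<lambda>s. s m"]) auto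
  have "C = (\<Inter>m. \<Inter>n\<in>{m..}. {s. dist (q (s m)) (q (s n)) \<le> (1/2)^m})" by (auto simp: C_def)
  also have "closed \<dots>" by (intro closed_INT ballI closed_Collect_le continuous_intros cq)
  finally have C: "closed C" .
  define f where "f s = lim (\<lambda>n. q (s n))" for s
  have conv: "(\<lambda>n. q (s n)) \<longlonglongrightarrow> f s" if "s \<in> C" for s
  proof -
    have "Cauchy (\<lambda>n. q (s n))"
    proof (rule metric_CauchyI)
      fix e :: real assume "e > 0"
      then obtain k where k: "(1/2)^k < e/2" using real_arch_pow_inv[of "e/2" "1/2"] by auto
      show "\<exists>M. \<forall>m\<ge>M. \<forall>n\<ge>M. dist (q (s m)) (q (s n)) < e"
      proof (intro exI allI impI)
        fix m n assume "k \<le> m" "k \<le> n"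
        then have "dist (q (s k)) (q (s m)) \<le> (1/2)^k" "dist (q (s k)) (q (s n)) \<le> (1/2)^k"
          using that by (auto simp: C_def)
        then show "dist (q (s m)) (q (s n)) < e"
          using k dist_triangle3[of "q (s m)" "q (s n)" "q (s k)"] by linarith
      qed
    qed
    then show ?thesis using Cauchy_convergent convergent_LIMSEQ_iff by (auto simp: f_def)
  qed
  have close: "dist (q (s n)) (f s) \<le> (1/2)^n" if "s \<in> C" for s n
    by (rule LIMSEQ_le_const2[OF tendsto_dist[OF tendsto_const conv[OF that]]])
      (use that in \<open>auto simp: C_def\<close>)
  have "continuous_on C f"
    unfolding continuous_on_topological
  proof (intro ballI allI impI)
    fix s B assume s: "s \<in> C" "open B" "f s \<in> B"
    then obtain e where e: "e > 0" "ball (f s) e \<subseteq> B" by (meson open_contains_ball)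
    obtain k where k: "(1/2)^k < e/2" using real_arch_pow_inv[of "e/2" "1/2"] e by auto
    have "f t \<in> B" if t: "t \<in> C" "t \<in> cyl (Suc k) s" for t
    proof -
      have "t k = s k" using t by (simp add: cyl_def)
      then have "dist (q (s k)) (f t) \<le> (1/2)^k" using close[OF t(1), of k] by simp
      then have "dist (f s) (f t) < e"
        using close[OF s(1), of k] k dist_triangle3[of "f s" "f t" "q (s k)"] by linarith
      then show ?thesis using e by auto
    qed
    then show "\<exists>A. open A \<and> s \<in> A \<and> (\<forall>y\<in>C. y \<in> A \<longrightarrow> f y \<in> B)"
      by (intro exI[of _ "cyl (Suc k) s"]) (auto simp: open_cyl, simp add: cyl_def)
  qed
  moreover have "x \<in> f ` C" for x
  proof -
    \<comment> \<open>Half of the permitted error: two such terms add up to at most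
      \<open>(1/2)^m\<close>, as membership in \<open>C\<close> requires.\<close>
    have "\<exists>n. dist (q n) x < (1/2)^m/2" for m :: nat by (rule q) simp
    then obtain s where s: "\<And>m. dist (q (s m)) x < (1/2)^m/2" by metis
    have "s \<in> C" unfolding C_def
    proof (intro CollectI allI impI)
      fix m n :: nat assume "m \<le> n"
      then have "(1/2::real)^n \<le> (1/2)^m" by (intro power_decreasing) auto
      then show "dist (q (s m)) (q (s n)) \<le> (1/2)^m"
        using s[of m] s[of n] dist_triangle2[of "q (s m)" "q (s n)" x] by linarith
    qed
    moreover have "(\<lambda>n. q (s n)) \<longlonglongrightarrow> x"
    proof (rule metric_tendsto_imp_tendsto[where f = "\<lambda>n. (1/2::real)^n"])
      show "(\<lambda>n. (1/2::real)^n) \<longlonglongrightarrow> 0" by (intro LIMSEQ_power_zero) auto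
      show "eventually (\<lambda>n. dist (q (s n)) x \<le> dist ((1/2::real)^n) 0) sequentially"
      proof (intro always_eventually allI)
        fix n
        have "dist ((1/2::real)^n) 0 = (1/2)^n" by (simp add: dist_norm)
        moreover have "(0::real) < (1/2)^n" by simp
        ultimately show "dist (q (s n)) x \<le> dist ((1/2::real)^n) 0" using s[of n] by linarith
      qed
    qed
    ultimately have "f s = x" using conv LIMSEQ_unique by blast
    then show ?thesis using \<open>s \<in> C\<close> by auto
  qed
  ultimately show thesis using that[OF C, of f] by auto
qed

section \<open>Closure properties of analytic sets\<close>

lemma closed_analytic:
  fixes S :: "'a::polish_space set" assumes "closed S" shows "analytic S"
proof -
  obtain C :: "(nat \<Rightarrow> nat) set" and f :: "(nat \<Rightarrow> nat) \<Rightarrow> 'a"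
    where C: "closed C" "continuous_on C f" "f ` C = UNIV" by (rule polish_Baire_image)
  have "closed (C \<inter> f -` S)" using C assms by (intro continuous_closed_preimage)
  moreover have "continuous_on (C \<inter> f -` S) f" using C by (auto intro: continuous_on_subset)
  moreover have "f ` (C \<inter> f -` S) = f ` C \<inter> S" by auto
  then have "S = f ` (C \<inter> f -` S)" by (simp add: C(3))
  ultimately show ?thesis unfolding analytic_def by blast
qed

text \<open>The first entry of a sequence selects the set, and the shifted sequence is fed to the
  map of that set.\<close>

lemma analytic_UN:
  assumes "\<And>n::nat. analytic (A n)" shows "analytic (\<Union>n. A n)"
proof -
  obtain C f where Cf: "\<And>n. closed (C n :: (nat \<Rightarrow> nat) set)" "\<And>n. continuous_on (C n) (f n)"
    "\<And>n. A n = f n ` C n"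
    using assms unfolding analytic_def by metis
  define sh where "sh s i = s (Suc i)" for s :: "nat \<Rightarrow> nat" and i
  have csh: "continuous_on UNIV sh"
    unfolding sh_def by (intro continuous_on_coordinatewise_then_product continuous_on_product_coordinates)
  define C' where "C' = {s. sh s \<in> C (s 0)}"
  define f' where "f' s = f (s 0) (sh s)" for s
  have osl: "open ({s. s 0 = n} \<inter> sh -` U)" if "open U" for n U
  proof -
    have "{s::nat\<Rightarrow>nat. s 0 = n} = cyl 1 (\<lambda>_. n)" by (auto simp: cyl_def)
    then show ?thesis using open_cyl open_vimage[OF that csh] by auto
  qed
  have "- C' = (\<Union>n. {s. s 0 = n} \<inter> sh -` (- C n))" by (auto simp: C'_def)
  then have "open (- C')" using Cf(1) by (auto intro!: open_UN osl)
  then have "closed C'" by (simp add: closed_def)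
  moreover have "continuous_on C' f'"
    unfolding continuous_on_topological
  proof (intro ballI allI impI)
    fix s B assume s: "s \<in> C'" "open B" "f' s \<in> B"
    then have "sh s \<in> C (s 0)" "f (s 0) (sh s) \<in> B" by (auto simp: C'_def f'_def)
    then obtain U where U: "open U" "sh s \<in> U" "\<And>y. y \<in> C (s 0) \<Longrightarrow> y \<in> U \<Longrightarrow> f (s 0) y \<in> B"
      using Cf(2)[of "s 0"] s(2) unfolding continuous_on_topological by meson
    then show "\<exists>A. open A \<and> s \<in> A \<and> (\<forall>y\<in>C'. y \<in> A \<longrightarrow> f' y \<in> B)"
      by (intro exI[of _ "{t. t 0 = s 0} \<inter> sh -` U"] conjI osl) (auto simp: C'_def f'_def)
  qed
  moreover have "(\<Union>n. A n) = f' ` C'"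
  proof (intro equalityI subsetI)
    fix x assume "x \<in> (\<Union>n. A n)"
    then obtain n t where t: "t \<in> C n" "x = f n t" by (auto simp: Cf)
    have "sh (case_nat n t) = t" by (auto simp: sh_def)
    then show "x \<in> f' ` C'" using t by (intro image_eqI[of _ _ "case_nat n t"]) (auto simp: f'_def C'_def)
  qed (auto simp: Cf f'_def C'_def)
  ultimately show ?thesis unfolding analytic_def by blast
qed

text \<open>A single sequence holds countably many rows through \<open>prod_encode\<close>. The
  sequences whose rows all have the same image form a closed set, because the diagonal of a
  Hausdorff square is closed; the common image is a point of the intersection.\<close>

lemma analytic_INT:
  fixes A :: "nat \<Rightarrow> 'a::t2_space set"
  assumes "\<And>n::nat. analytic (A n)" shows "analytic (\<Inter>n. A n)"
proof -
  obtain C f where Cf: "\<And>n. closed (C n :: (nat \<Rightarrow> nat) set)" "\<And>n. continuous_on (C n) (f n)"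
    "\<And>n. A n = f n ` C n"
    using assms unfolding analytic_def by metis
  define row where "row i s = (\<lambda>j. s (prod_encode (i, j)))" for i and s :: "nat \<Rightarrow> nat"
  have crow: "continuous_on X (row i)" for i X
    unfolding row_def
    by (intro continuous_on_coordinatewise_then_product continuous_on_subset[OF continuous_on_product_coordinates]) auto
  define D where "D = (\<Inter>i. row i -` C i)"
  have cD: "closed D" unfolding D_def by (intro closed_INT ballI closed_vimage crow Cf)
  have cf: "continuous_on D (\<lambda>s. f i (row i s))" for i
    by (rule continuous_on_compose2[OF Cf(2)[of i] crow]) (auto simp: D_def)
  define C' where "C' = (\<Inter>i. D \<inter> (\<lambda>s. (f i (row i s), f 0 (row 0 s))) -` {y. \<exists>x. y = (x, x)})"
  have "closed C'" unfolding C'_def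
    by (intro closed_INT ballI continuous_closed_preimage continuous_on_Pair cf cD closed_diagonal)
  moreover have "continuous_on C' (\<lambda>s. f 0 (row 0 s))"
    by (rule continuous_on_subset[OF cf]) (auto simp: C'_def)
  moreover have "(\<Inter>n. A n) = (\<lambda>s. f 0 (row 0 s)) ` C'"
  proof (intro equalityI subsetI)
    fix x assume "x \<in> (\<Inter>n. A n)"
    then have "\<forall>n. \<exists>t. t \<in> C n \<and> x = f n t" by (auto simp: Cf)
    then obtain t where t: "\<And>n. t n \<in> C n" "\<And>n. x = f n (t n)" by metis
    define s where "s k = t (fst (prod_decode k)) (snd (prod_decode k))" for k
    have "row i s = t i" for i by (simp add: row_def s_def)
    then have "s \<in> C'" "x = f 0 (row 0 s)" using t by (auto simp: C'_def D_def)
    then show "x \<in> (\<lambda>s. f 0 (row 0 s)) ` C'" by blast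
  next
    fix x assume "x \<in> (\<lambda>s. f 0 (row 0 s)) ` C'"
    then obtain s where s: "s \<in> C'" "x = f 0 (row 0 s)" by auto
    then have "x = f i (row i s) \<and> row i s \<in> C i" for i by (auto simp: C'_def D_def)
    then show "x \<in> (\<Inter>n. A n)" by (auto simp: Cf)
  qed
  ultimately show ?thesis unfolding analytic_def by blast
qed

lemma open_analytic:
  fixes S :: "'a::polish_space set" assumes "open S" shows "analytic S"
\<comment> \<open>\<open>infdist\<close> to the empty set is 0 by convention, so the decomposition
  by distance to the complement needs a nonempty complement.\<close>
proof (cases "S = UNIV")
  case True then show ?thesis by (auto intro: closed_analytic)
next
  case False
  have "S = (\<Union>n. {x. inverse (real (Suc n)) \<le> infdist x (- S)})"
  proof (intro equalityI subsetI)
    fix x assume "x \<in> S"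
    then have "infdist x (- S) > 0"
      using assms False infdist_pos_not_in_closed[of "- S" x] by auto
    then obtain n where "inverse (real (Suc n)) < infdist x (- S)" using reals_Archimedean by blast
    then show "x \<in> (\<Union>n. {x. inverse (real (Suc n)) \<le> infdist x (- S)})" by (auto intro: less_imp_le)
  next
    fix x assume "x \<in> (\<Union>n. {x. inverse (real (Suc n)) \<le> infdist x (- S)})"
    then obtain n where "inverse (real (Suc n)) \<le> infdist x (- S)" by auto
    then show "x \<in> S" by (metis ComplI infdist_zero inverse_positive_iff_positive not_le of_nat_0_less_iff zero_less_Suc)
  qed
  moreover have "analytic (\<Union>n. {x. inverse (real (Suc n)) \<le> infdist x (- S)})"
    by (intro analytic_UN closed_analytic closed_Collect_le continuous_intros)
  ultimately show ?thesis by metis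
qed

text \<open>Analyticity does not pass to complements, so the induction over the sigma-algebra
  carries \<open>S\<close> and \<open>- S\<close> together.\<close>

lemma borel_analytic:
  fixes S :: "'a::polish_space set" assumes "S \<in> sets borel" shows "analytic S"
proof -
  have "S \<in> sigma_sets UNIV {S. open S}" using assms by (simp add: borel_def)
  then have "analytic S \<and> analytic (- S)"
  proof induction
    case (Basic a) then show ?case by (auto intro: open_analytic closed_analytic simp: closed_def)
  next
    case Empty show ?case by (auto intro: open_analytic)
  next
    case (Compl a) then show ?case by (auto simp: Compl_eq_Diff_UNIV[symmetric])
  next
    case (Union a)
    then show ?case using analytic_UN[of a] analytic_INT[of "\<lambda>i. - a i"] by (auto simp: Compl_UN)
  qed
  then show ?thesis ..
qed

text \<open>If all pairs of pieces can be separated, so can their countable unions. An inseparable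
  pair therefore contains inseparable images of ever smaller cylinders, which shrink to points
  \<open>a\<close> and \<open>b\<close>. There disjoint open sets around \<open>f a\<close> and
  \<open>g b\<close> do separate, by continuity.\<close>

lemma Lusin_separation:
  fixes A B :: "'a::t2_space set"
  assumes A: "analytic A" and B: "analytic B" and dis: "A \<inter> B = {}"
  obtains S where "S \<in> sets borel" "A \<subseteq> S" "S \<inter> B = {}"
proof -
  obtain C f where C: "closed (C :: (nat \<Rightarrow> nat) set)" "continuous_on C f" "A = f ` C"
    using A by (auto simp: analytic_def)
  obtain D g where D: "closed (D :: (nat \<Rightarrow> nat) set)" "continuous_on D g" "B = g ` D"
    using B by (auto simp: analytic_def)
  define sep where "sep P Q \<longleftrightarrow> (\<exists>S::'a set\<in>sets borel. P \<subseteq> S \<and> S \<inter> Q = {})" for P Q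
  have sepUN: "sep (\<Union>i::nat. P i) (\<Union>j::nat. Q j)" if "\<And>i j. sep (P i) (Q j)" for P Q
  proof -
    have "\<forall>i j. \<exists>S :: 'a set. S \<in> sets borel \<and> P i \<subseteq> S \<and> S \<inter> Q j = {}"
      using that by (simp add: sep_def Bex_def)
    then obtain S where S: "\<And>i j. S i j \<in> sets borel" "\<And>i j. P i \<subseteq> S i j" "\<And>i j. S i j \<inter> Q j = {}"
      by metis
    have "(\<Union>i. \<Inter>j. S i j) \<in> sets borel" using S(1) by (intro sets.countable_UN sets.countable_INT) auto
    moreover have "(\<Union>i. P i) \<subseteq> (\<Union>i. \<Inter>j. S i j)" using S(2) by blast
    moreover have "(\<Union>i. \<Inter>j. S i j) \<inter> (\<Union>j. Q j) = {}" using S(3) by blast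
    ultimately show ?thesis unfolding sep_def by blast
  qed
  define bad where "bad n p \<longleftrightarrow> \<not> sep (f ` (C \<inter> cyl n (fst p))) (g ` (D \<inter> cyl n (snd p)))" for n p
  define ext where "ext n p p' \<longleftrightarrow> (\<exists>i j. p' = ((fst p)(n := i), (snd p)(n := j)))"
    for n :: nat and p p' :: "(nat \<Rightarrow> nat) \<times> (nat \<Rightarrow> nat)"
  have split: "X \<inter> cyl n a = (\<Union>i. X \<inter> cyl (Suc n) (a(n := i)))" for X n a
  proof -
    have "cyl n a = (\<Union>i. cyl (Suc n) (a(n := i)))"
      by (auto simp: cyl_def less_Suc_eq)
    then show ?thesis by blast
  qed
  have "sep A B"
  proof (rule ccontr)
    assume nsep: "\<not> sep A B"
    have "\<exists>F. \<forall>n. bad n (F n) \<and> ext n (F n) (F (Suc n))"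
    proof (rule dependent_nat_choice)
      show "\<exists>p. bad 0 p" using nsep by (simp add: bad_def cyl_def C D)
    next
      fix p n assume b: "bad n p"
      have "\<exists>i j. bad (Suc n) ((fst p)(n := i), (snd p)(n := j))"
      proof (rule ccontr)
        assume "\<not> ?thesis"
        then have "sep (\<Union>i. f ` (C \<inter> cyl (Suc n) ((fst p)(n := i)))) (\<Union>j. g ` (D \<inter> cyl (Suc n) ((snd p)(n := j))))"
          by (intro sepUN) (auto simp: bad_def)
        then show False using b unfolding bad_def split[of C n] split[of D n] image_UN by simp
      qed
      then show "\<exists>p'. bad (Suc n) p' \<and> ext n p p'" by (auto simp: ext_def)
    qed
    then obtain F where F: "\<And>n. bad n (F n)" "\<And>n. ext n (F n) (F (Suc n))" by blast
    \<comment> \<open>Entry \<open>i\<close> is chosen in passing from stage \<open>i\<close> to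
      stage \<open>Suc i\<close> and never changed later, so \<open>Suc i\<close> is the first stage
      that shows its final value.\<close>
    define a where "a i = fst (F (Suc i)) i" for i
    define b where "b i = snd (F (Suc i)) i" for i
    have ab: "\<forall>i<n. fst (F n) i = a i \<and> snd (F n) i = b i" for n
    proof (induction n)
      case (Suc n)
      then show ?case using F(2)[of n] by (auto simp: ext_def less_Suc_eq a_def b_def)
    qed simp
    have cyls: "cyl n (fst (F n)) = cyl n a" "cyl n (snd (F n)) = cyl n b" for n
      using ab[of n] by (auto simp: cyl_def)
    have bad: "\<not> sep (f ` (C \<inter> cyl n a)) (g ` (D \<inter> cyl n b))" for n
      using F(1)[of n] by (simp add: bad_def cyls)
    have mem: "x \<in> X" if X: "closed X" and ne: "\<And>n. X \<inter> cyl n x \<noteq> {}" for X x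
    proof -
      have "\<forall>n. \<exists>t. t \<in> X \<inter> cyl n x" using ne by blast
      from choice[OF this] obtain s where "\<And>n. s n \<in> X \<inter> cyl n x" by blast
      then show ?thesis using closed_sequentially[OF X, of s x] tendsto_cyl[of s x] by auto
    qed
    \<comment> \<open>An empty piece is trivially separated, so the pieces of an inseparable pair
      are nonempty; closedness then puts the limits into \<open>C\<close> and
      \<open>D\<close>.\<close>
    have "sep {} Q" "sep P {}" for P Q unfolding sep_def by (auto intro: bexI[of _ "{}"] bexI[of _ UNIV])
    then have ne: "C \<inter> cyl n a \<noteq> {}" "D \<inter> cyl n b \<noteq> {}" for n using bad[of n] by auto
    have a: "a \<in> C" and b: "b \<in> D" using mem[OF C(1) ne(1)] mem[OF D(1) ne(2)] by auto
    then have "f a \<noteq> g b" using dis C(3) D(3) by blast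
    then obtain U V where UV: "open U" "open V" "f a \<in> U" "g b \<in> V" "U \<inter> V = {}"
      using hausdorff[of "f a" "g b"] by metis
    obtain U' where U': "open U'" "a \<in> U'" "\<And>y. y \<in> C \<Longrightarrow> y \<in> U' \<Longrightarrow> f y \<in> U"
      using C(2) a UV unfolding continuous_on_topological by metis
    obtain V' where V': "open V'" "b \<in> V'" "\<And>y. y \<in> D \<Longrightarrow> y \<in> V' \<Longrightarrow> g y \<in> V"
      using D(2) b UV unfolding continuous_on_topological by metis
    obtain m n where mn: "cyl m a \<subseteq> U'" "cyl n b \<subseteq> V'"
      using open_cyl_subset U' V' by metis
    have sub: "cyl (max m n) a \<subseteq> cyl m a" "cyl (max m n) b \<subseteq> cyl n b" by (auto simp: cyl_def)
    have "f ` (C \<inter> cyl (max m n) a) \<subseteq> U" using U'(3) mn sub by blast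
    moreover have "g ` (D \<inter> cyl (max m n) b) \<subseteq> V" using V'(3) mn sub by blast
    ultimately have "sep (f ` (C \<inter> cyl (max m n) a)) (g ` (D \<inter> cyl (max m n) b))"
      using UV unfolding sep_def by (intro bexI[of _ U]) auto
    then show False using bad by blast
  qed
  then show thesis using that by (auto simp: sep_def)
qed

text \<open>The relative form of Suslin's theorem: the separating set cuts \<open>A\<close> out of
  the Borel union.\<close>

lemma analytic_partition_borel:
  fixes A B :: "'a::t2_space set"
  assumes "analytic A" "analytic B" "A \<inter> B = {}" "A \<union> B \<in> sets borel"
  shows "A \<in> sets borel"
proof -
  obtain S where S: "S \<in> sets borel" "A \<subseteq> S" "S \<inter> B = {}" using Lusin_separation assms(1-3) by metis
  then have "A = S \<inter> (A \<union> B)" by blast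
  then show ?thesis using S assms(4) by (metis sets.Int)
qed

text \<open>Summing over a fixed number of neighbours is measurable: the sets where the sum lies in \<open>V\<close>
  and in \<open>- V\<close> are both projections of Borel sets of vertex-neighbour tuples \<open>z\<close>, with vertex
  \<open>z 0\<close> and neighbours \<open>z 1, \<dots>, z d\<close>.\<close>
lemma neighbour_sum_measurable:
  fixes E :: "'a::polish_space \<Rightarrow> 'a \<Rightarrow> bool"
    and F :: "'a \<times> 'a \<Rightarrow> 'c::{second_countable_topology, topological_comm_monoid_add}"
  assumes X1: "X1 \<in> sets borel" and E: "{(x, y). E x y} \<in> sets borel"
    and reg: "\<And>x. x \<in> X1 \<Longrightarrow> finite (neighbours E x) \<and> card (neighbours E x) = d"
    and F: "F \<in> borel_measurable borel"
  shows "(\<lambda>x. if x \<in> X1 then \<Sum>y\<in>neighbours E x. F (x, y) else 0) \<in> borel_measurable borel"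
proof -
  define h where "h x = (\<Sum>y\<in>neighbours E x. F (x, y))" for x
  define W where "W V = {z :: nat \<Rightarrow> 'a. z 0 \<in> X1 \<and> (\<forall>i<d. E (z 0) (z (Suc i))) \<and>
      (\<forall>i<d. \<forall>j<i. z (Suc i) \<noteq> z (Suc j)) \<and> (\<Sum>i<d. F (z 0, z (Suc i))) \<in> V}" for V
  have proj: "(\<lambda>z::nat\<Rightarrow>'a. z i) \<in> borel_measurable borel" for i
    by (rule borel_measurable_continuous_onI[OF continuous_on_product_coordinates])
  have WB: "W V \<in> sets borel" if V: "V \<in> sets borel" for V
  proof -
    have pr: "(\<lambda>z::nat\<Rightarrow>'a. (z i, z j)) \<in> borel_measurable borel" for i j
      by (intro borel_measurable_Pair proj)
    have 1: "(\<lambda>z::nat\<Rightarrow>'a. z 0) -` X1 \<in> sets borel" using measurable_sets[OF proj X1] by simp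
    have 2: "(\<lambda>z::nat\<Rightarrow>'a. (z 0, z (Suc i))) -` {(x, y). E x y} \<in> sets borel" for i
      using measurable_sets[OF pr E] by simp
    have "open {p :: 'a \<times> 'a. fst p \<noteq> snd p}" by (intro open_Collect_neq continuous_intros)
    moreover have "{(x, y). x \<noteq> (y::'a)} = {p. fst p \<noteq> snd p}" by auto
    ultimately have dg: "{(x, y). x \<noteq> (y::'a)} \<in> sets borel" by simp
    have 3: "(\<lambda>z::nat\<Rightarrow>'a. (z (Suc i), z (Suc j))) -` {(x, y). x \<noteq> y} \<in> sets borel" for i j
      using measurable_sets[OF pr dg] by simp
    have "(\<lambda>z. \<Sum>i<d. F (z 0, z (Suc i))) \<in> borel_measurable borel"
      by (intro borel_measurable_sum measurable_compose[OF pr F])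
    from measurable_sets[OF this V]
    have 4: "(\<lambda>z. \<Sum>i<d. F (z 0, z (Suc i))) -` V \<in> sets borel" by simp
    have "W V = (\<lambda>z. z 0) -` X1 \<inter> (\<Inter>i\<in>{..<d}. (\<lambda>z. (z 0, z (Suc i))) -` {(x, y). E x y} \<inter> UNIV) \<inter>
        (\<Inter>i\<in>{..<d}. (\<Inter>j\<in>{..<i}. (\<lambda>z. (z (Suc i), z (Suc j))) -` {(x, y). x \<noteq> y})) \<inter>
        (\<lambda>z. \<Sum>i<d. F (z 0, z (Suc i))) -` V"
      by (auto simp: W_def)
    moreover have "(\<Inter>i\<in>{..<k}. S i) \<in> sets (borel :: (nat \<Rightarrow> 'a) measure)"
      if "\<And>i. S i \<in> sets borel" for S :: "nat \<Rightarrow> (nat \<Rightarrow> 'a) set" and k :: nat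
      by (induction k) (auto simp: lessThan_Suc that)
    ultimately show ?thesis using 1 2 3 4 by auto
  qed
  have img: "(\<lambda>z. z 0) ` W V = {x\<in>X1. h x \<in> V}" for V
  proof (intro equalityI subsetI)
    fix x assume "x \<in> (\<lambda>z. z 0) ` W V"
    then obtain z where z: "z \<in> W V" "x = z 0" by auto
    have inj: "inj_on (\<lambda>i. z (Suc i)) {..<d}"
      using z(1) unfolding W_def inj_on_def by (metis (mono_tags, lifting) lessThan_iff linorder_neqE_nat mem_Collect_eq)
    \<comment> \<open>\<open>d\<close> distinct neighbours of a vertex with exactly \<open>d\<close>
      neighbours are all of them, so the sum does not depend on the tuple.\<close>
    have "(\<lambda>i. z (Suc i)) ` {..<d} = neighbours E x"
    proof (rule card_subset_eq)
      show "finite (neighbours E x)" "(\<lambda>i. z (Suc i)) ` {..<d} \<subseteq> neighbours E x"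
        using z reg by (auto simp: W_def neighbours_def)
      show "card ((\<lambda>i. z (Suc i)) ` {..<d}) = card (neighbours E x)"
        using card_image[OF inj] z reg by (auto simp: W_def)
    qed
    then have "h x = (\<Sum>i<d. F (z 0, z (Suc i)))"
      unfolding h_def using sum.reindex[OF inj, of "\<lambda>y. F (x, y)"] z by simp
    then show "x \<in> {x\<in>X1. h x \<in> V}" using z by (auto simp: W_def)
  next
    fix x assume x: "x \<in> {x\<in>X1. h x \<in> V}"
    then obtain b where b: "bij_betw b {..<d} (neighbours E x)"
      using reg[of x] ex_bij_betw_nat_finite[of "neighbours E x"] by (auto simp: atLeast0LessThan)
    have "h x = (\<Sum>i<d. F (x, b i))"
      unfolding h_def using sum.reindex_bij_betw[OF b, of "\<lambda>y. F (x, y)"] by simp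
    moreover have "b i \<noteq> b j" if "i < d" "j < i" for i j
      using inj_onD[OF bij_betw_imp_inj_on[OF b], of i j] that by auto
    moreover have "E x (b i)" if "i < d" for i using b that by (auto simp: bij_betw_def neighbours_def)
    ultimately show "x \<in> (\<lambda>z. z 0) ` W V"
      using x by (intro image_eqI[of _ _ "case_nat x b"]) (auto simp: W_def)
  qed
  have an: "analytic {x\<in>X1. h x \<in> V}" if "V \<in> sets borel" for V
    unfolding img[symmetric]
    by (intro analytic_image borel_analytic WB that continuous_on_subset[OF continuous_on_product_coordinates]) auto
  have hV: "{x\<in>X1. h x \<in> V} \<in> sets borel" if V: "V \<in> sets borel" for V
  proof (rule analytic_partition_borel[OF an[OF V] an[of "- V"]])
    show "- V \<in> sets borel" using V by (metis borel_comp)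
    have "{x\<in>X1. h x \<in> V} \<union> {x\<in>X1. h x \<in> - V} = X1" by auto
    then show "{x\<in>X1. h x \<in> V} \<union> {x\<in>X1. h x \<in> - V} \<in> sets borel" using X1 by simp
  qed auto
  show ?thesis
  proof (rule measurableI)
    fix V :: "'c set" assume V: "V \<in> sets borel"
    have "(\<lambda>x. if x \<in> X1 then \<Sum>y\<in>neighbours E x. F (x, y) else 0) -` V \<inter> space borel =
        {x\<in>X1. h x \<in> V} \<union> (if 0 \<in> V then - X1 else {})"
      by (auto simp: h_def split: if_splits)
    moreover have "- X1 \<in> sets borel" using X1 by (metis borel_comp)
    ultimately show "(\<lambda>x. if x \<in> X1 then \<Sum>y\<in>neighbours E x. F (x, y) else 0) -` V \<inter> space borel \<in> sets borel"
      using hV[OF V] by auto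
  qed simp
qed

section \<open>Positive operators on complete semi-inner product spaces\<close>

text \<open>The discriminant argument. It is stated for an arbitrary semidefinite form because it
  serves twice: for the inner product and, in \<open>posop_sq\<close>, for the form of a positive
  operator.\<close>

lemma form_cauchy_schwarz:
  fixes B :: "'v::real_vector \<Rightarrow> 'v \<Rightarrow> real"
  assumes H: "subspace H" and f: "f \<in> H" and g: "g \<in> H"
    and sym: "\<And>f g. f \<in> H \<Longrightarrow> g \<in> H \<Longrightarrow> B f g = B g f"
    and add: "\<And>f g h. f \<in> H \<Longrightarrow> g \<in> H \<Longrightarrow> h \<in> H \<Longrightarrow> B (f + g) h = B f h + B g h"
    and scale: "\<And>c f g. f \<in> H \<Longrightarrow> g \<in> H \<Longrightarrow> B (c *\<^sub>R f) g = c * B f g"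
    and nonneg: "\<And>f. f \<in> H \<Longrightarrow> 0 \<le> B f f"
  shows "(B f g)\<^sup>2 \<le> B f f * B g g"
proof -
  have ex: "0 \<le> B f f + 2 * t * B f g + t\<^sup>2 * B g g" for t
  proof -
    have tg: "t *\<^sub>R g \<in> H" "f + t *\<^sub>R g \<in> H"
      using H f g by (auto intro: subspace_scale subspace_add)
    have "B (f + t *\<^sub>R g) (f + t *\<^sub>R g) = B f f + 2 * t * B f g + t\<^sup>2 * B g g"
      using tg f g sym[of f "f + t *\<^sub>R g"] sym[of g "f + t *\<^sub>R g"] sym[of g f]
      by (simp add: add scale algebra_simps power2_eq_square)
    then show ?thesis using nonneg[OF tg(2)] by simp
  qed
  show ?thesis
  proof (cases "B g g = 0")
    case True
    have "B f g = 0"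
    proof (rule ccontr)
      assume "B f g \<noteq> 0"
      \<comment> \<open>With \<open>B g g = 0\<close> the polynomial is affine, and this value of
        \<open>t\<close> brings it down to -1.\<close>
      then have "2 * (- (B f f + 1) / (2 * B f g)) * B f g = - (B f f + 1)" by simp
      then show False using ex[of "- (B f f + 1) / (2 * B f g)"] True by simp
    qed
    then show ?thesis using True by simp
  next
    case False
    then have p: "B g g > 0" using nonneg[OF g] by simp
    \<comment> \<open>The value of the polynomial at its minimum.\<close>
    have "0 \<le> B f f - (B f g)\<^sup>2 / B g g"
      using ex[of "- B f g / B g g"] p by (simp add: power2_eq_square field_simps)
    then show ?thesis using p by (simp add: field_simps)
  qed
qed

text \<open>Only semidefinite, because the vectors will be functions rather than classes modulo null
  sets.\<close>

locale semi_inner =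
  fixes H :: "'v::real_vector set" and ip :: "'v \<Rightarrow> 'v \<Rightarrow> real"
  assumes subsp: "subspace H"
    and ip_sym: "f \<in> H \<Longrightarrow> g \<in> H \<Longrightarrow> ip f g = ip g f"
    and ip_add: "f \<in> H \<Longrightarrow> g \<in> H \<Longrightarrow> h \<in> H \<Longrightarrow> ip (f + g) h = ip f h + ip g h"
    and ip_scale: "f \<in> H \<Longrightarrow> g \<in> H \<Longrightarrow> ip (c *\<^sub>R f) g = c * ip f g"
    and ip_nonneg: "f \<in> H \<Longrightarrow> 0 \<le> ip f f"
begin

definition nm :: "'v \<Rightarrow> real" where "nm f = sqrt (ip f f)"

definition symop :: "('v \<Rightarrow> 'v) \<Rightarrow> bool" where
  "symop A \<longleftrightarrow> (\<forall>f\<in>H. A f \<in> H) \<and> (\<forall>f\<in>H. \<forall>g\<in>H. A (f + g) = A f + A g) \<and>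
    (\<forall>c. \<forall>f\<in>H. A (c *\<^sub>R f) = c *\<^sub>R A f) \<and> (\<forall>f\<in>H. \<forall>g\<in>H. ip (A f) g = ip f (A g))"

definition posop :: "real \<Rightarrow> ('v \<Rightarrow> 'v) \<Rightarrow> bool" where
  "posop c A \<longleftrightarrow> 0 \<le> c \<and> symop A \<and> (\<forall>f\<in>H. 0 \<le> ip (A f) f \<and> ip (A f) f \<le> c * ip f f)"

text \<open>Onto up to vectors of norm zero, which matches solvability almost everywhere in
  \<open>adjacency_spectrum\<close>.\<close>

definition surjop :: "('v \<Rightarrow> 'v) \<Rightarrow> bool" where
  "surjop A \<longleftrightarrow> (\<forall>g\<in>H. \<exists>f\<in>H. nm (A f - g) = 0)"

lemma H_closed [simp, intro]:
  "0 \<in> H" "f \<in> H \<Longrightarrow> g \<in> H \<Longrightarrow> f + g \<in> H" "f \<in> H \<Longrightarrow> g \<in> H \<Longrightarrow> f - g \<in> H"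
  "f \<in> H \<Longrightarrow> c *\<^sub>R f \<in> H" "f \<in> H \<Longrightarrow> - f \<in> H"
  using subsp by (auto intro: subspace_0 subspace_add subspace_diff subspace_scale subspace_neg)

lemma ip_minus: "f \<in> H \<Longrightarrow> g \<in> H \<Longrightarrow> ip (- f) g = - ip f g"
  using ip_scale[of f g "-1"] by simp

lemma ip_diff: "f \<in> H \<Longrightarrow> g \<in> H \<Longrightarrow> h \<in> H \<Longrightarrow> ip (f - g) h = ip f h - ip g h"
  using ip_add[of f "- g" h] by (simp add: ip_minus)

lemma ip_add_right: "f \<in> H \<Longrightarrow> g \<in> H \<Longrightarrow> h \<in> H \<Longrightarrow> ip h (f + g) = ip h f + ip h g"
  using ip_add[of f g h] by (simp add: ip_sym)

lemma ip_diff_right: "f \<in> H \<Longrightarrow> g \<in> H \<Longrightarrow> h \<in> H \<Longrightarrow> ip h (f - g) = ip h f - ip h g"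
  using ip_diff[of f g h] by (simp add: ip_sym)

lemma ip_scale_right: "f \<in> H \<Longrightarrow> g \<in> H \<Longrightarrow> ip g (c *\<^sub>R f) = c * ip g f"
  using ip_scale[of f g c] by (simp add: ip_sym)

lemmas ip_simps = ip_add ip_diff ip_minus ip_scale ip_add_right ip_diff_right ip_scale_right

lemma nm_nonneg [simp]: "f \<in> H \<Longrightarrow> 0 \<le> nm f"
  by (simp add: nm_def ip_nonneg)

lemma nm_sq: "f \<in> H \<Longrightarrow> (nm f)\<^sup>2 = ip f f"
  by (simp add: nm_def ip_nonneg)

lemma ip_cs: "f \<in> H \<Longrightarrow> g \<in> H \<Longrightarrow> \<bar>ip f g\<bar> \<le> nm f * nm g"
proof -
  assume f: "f \<in> H" and g: "g \<in> H"
  have "(ip f g)\<^sup>2 \<le> ip f f * ip g g"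
    by (rule form_cauchy_schwarz[OF subsp f g]) (rule ip_sym ip_add ip_scale ip_nonneg, assumption+)+
  also have "\<dots> = (nm f * nm g)\<^sup>2" by (simp add: power_mult_distrib nm_sq f g)
  finally have "\<bar>ip f g\<bar>\<^sup>2 \<le> (nm f * nm g)\<^sup>2" by simp
  then show ?thesis by (rule power2_le_imp_le) (simp add: f g)
qed

lemma nm_triangle: "f \<in> H \<Longrightarrow> g \<in> H \<Longrightarrow> nm (f + g) \<le> nm f + nm g"
proof -
  assume f: "f \<in> H" and g: "g \<in> H"
  have "(nm (f + g))\<^sup>2 = (nm f)\<^sup>2 + 2 * ip f g + (nm g)\<^sup>2"
    using f g by (simp add: nm_sq ip_simps ip_sym[of g f])
  also have "\<dots> \<le> (nm f + nm g)\<^sup>2"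
    using ip_cs[OF f g] by (simp add: power2_eq_square algebra_simps)
  finally show ?thesis by (rule power2_le_imp_le) (simp add: f g)
qed

lemma nm_scale: "f \<in> H \<Longrightarrow> nm (c *\<^sub>R f) = \<bar>c\<bar> * nm f"
  by (simp add: nm_def ip_simps real_sqrt_mult flip: mult.assoc power2_eq_square)

lemma nm_minus: "f \<in> H \<Longrightarrow> nm (- f) = nm f"
  using nm_scale[of f "-1"] by simp

lemma nm_triangle_diff: "f \<in> H \<Longrightarrow> g \<in> H \<Longrightarrow> nm (f - g) \<le> nm f + nm g"
  using nm_triangle[of f "- g"] by (simp add: nm_minus)

lemma symopD:
  assumes "symop A"
  shows "f \<in> H \<Longrightarrow> A f \<in> H" "f \<in> H \<Longrightarrow> g \<in> H \<Longrightarrow> A (f + g) = A f + A g"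
    "f \<in> H \<Longrightarrow> A (c *\<^sub>R f) = c *\<^sub>R A f" "f \<in> H \<Longrightarrow> g \<in> H \<Longrightarrow> ip (A f) g = ip f (A g)"
  using assms by (auto simp: symop_def)

lemma symop_diff:
  assumes "symop A" "f \<in> H" "g \<in> H" shows "A (f - g) = A f - A g"
  using symopD(2)[OF assms(1), of f "- g"] symopD(3)[OF assms(1), of g "-1"] assms(2,3) by simp

text \<open>Cauchy-Schwarz for the form \<open>ip (A f) g\<close>, taken at \<open>f\<close> and
  \<open>A f\<close>, with the upper bound applied to \<open>A f\<close>; then one factor
  \<open>ip (A f) (A f)\<close> cancels. In operator terms,
  \<open>A\<^sup>2 \<le> c A\<close>.\<close>

lemma posop_sq:
  assumes A: "posop c A" and f: "f \<in> H"
  shows "ip (A f) (A f) \<le> c * ip (A f) f"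
proof -
  have s: "symop A" and c: "0 \<le> c" and p: "\<And>f. f \<in> H \<Longrightarrow> 0 \<le> ip (A f) f"
    and le: "\<And>f. f \<in> H \<Longrightarrow> ip (A f) f \<le> c * ip f f"
    using A by (auto simp: posop_def)
  note d = symopD[OF s]
  have u: "A f \<in> H" using d f by simp
  have symA: "ip (A f) g = ip (A g) f" if "f \<in> H" "g \<in> H" for f g
    using that d(4)[of f g] ip_sym[of f "A g"] d(1) by simp
  have "(ip (A f) (A f))\<^sup>2 \<le> ip (A f) f * ip (A (A f)) (A f)"
    by (rule form_cauchy_schwarz[OF subsp f u, where B = "\<lambda>f g. ip (A f) g"])
      (auto simp: d(1-3) ip_simps p intro: symA)
  also have "\<dots> \<le> ip (A f) f * (c * ip (A f) (A f))"
    by (intro mult_left_mono le u p f)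
  finally have "ip (A f) (A f) * ip (A f) (A f) \<le> (c * ip (A f) f) * ip (A f) (A f)"
    by (simp add: power2_eq_square algebra_simps)
  then show ?thesis
    using ip_nonneg[OF u] p[OF f] c by (cases "ip (A f) (A f) = 0") auto
qed

lemma posop_nm:
  assumes A: "posop c A" and f: "f \<in> H"
  shows "nm (A f) \<le> c * nm f"
proof (rule power2_le_imp_le)
  have c: "0 \<le> c" and u: "A f \<in> H" using A f by (auto simp: posop_def symop_def)
  have "ip (A f) (A f) \<le> c * (c * ip f f)"
    using posop_sq[OF A f] A f c by (meson mult_left_mono order_trans posop_def)
  then show "(nm (A f))\<^sup>2 \<le> (c * nm f)\<^sup>2"
    using u f by (simp add: power_mult_distrib nm_sq power2_eq_square[of c])
  show "0 \<le> c * nm f" using c f by simp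
qed

end

text \<open>Completeness is asked as convergence of absolutely summable series, because the limits
  constructed below are sums of geometrically bounded terms.\<close>

locale semi_hilbert = semi_inner +
  assumes complete: "(\<And>n. u n \<in> H) \<Longrightarrow> summable (\<lambda>n. sqrt (ip (u n) (u n))) \<Longrightarrow>
      \<exists>s\<in>H. (\<lambda>n. sqrt (ip (s - sum u {..<n}) (s - sum u {..<n}))) \<longlonglongrightarrow> 0"
begin

lemma complete_nm:
  assumes "\<And>n. u n \<in> H" "summable (\<lambda>n. nm (u n))"
  obtains s where "s \<in> H" "(\<lambda>n. nm (s - sum u {..<n})) \<longlonglongrightarrow> 0"
  using complete[of u] assms unfolding nm_def by blast

lemma sum_H: "(\<And>n. u n \<in> H) \<Longrightarrow> sum u {..<n::nat} \<in> H"
  by (induction n) auto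

text \<open>A gliding-hump argument: along unit vectors on which \<open>A\<close> decays geometrically, one builds a
  vector outside the range.\<close>
lemma posop_surj_imp_bounded_below:
  assumes A: "posop c A" and surj: "surjop A"
  obtains \<delta> where "\<delta> > 0" "\<And>f. f \<in> H \<Longrightarrow> \<delta> * ip f f \<le> ip (A f) f"
proof (rule ccontr)
  assume "\<not> thesis"
  then have neg: "\<delta> > 0 \<Longrightarrow> \<exists>f\<in>H. ip (A f) f < \<delta> * ip f f" for \<delta>
    using that[of \<delta>] by (meson not_le)
  have s: "symop A" and c: "0 \<le> c" and p: "\<And>f. f \<in> H \<Longrightarrow> 0 \<le> ip (A f) f"
    using A by (auto simp: posop_def)
  note d = symopD[OF s]
  have "\<exists>f. f \<in> H \<and> nm f = 1 \<and> nm (A f) \<le> (1/4)^n" for n :: nat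
  proof -
    \<comment> \<open>Chosen so that \<open>posop_sq\<close> gives
      \<open>nm (A f) \<le> (1/4)^n * nm f\<close>; the \<open>+ 1\<close> guards against
      \<open>c = 0\<close>.\<close>
    let ?d = "((1/4)^n)\<^sup>2 / (c + 1)"
    have "?d > 0" using c by simp
    then obtain f where f: "f \<in> H" and lt: "ip (A f) f < ?d * ip f f"
      using neg by blast
    then have pos: "ip f f > 0"
      using p[OF f] ip_nonneg[OF f] by (cases "ip f f = 0") auto
    then have nf: "nm f > 0" by (simp add: nm_def)
    have "ip (A f) (A f) \<le> c * (?d * ip f f)"
      using posop_sq[OF A f] lt c by (meson less_imp_le mult_left_mono order_trans)
    also have "\<dots> = (c / (c + 1)) * (((1/4)^n)\<^sup>2 * ip f f)" by simp
    also have "\<dots> \<le> ((1/4)^n)\<^sup>2 * ip f f"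
      using c pos by (intro mult_left_le_one_le) auto
    finally have "(nm (A f))\<^sup>2 \<le> ((1/4)^n * nm f)\<^sup>2"
      by (simp add: power_mult_distrib nm_sq f d)
    then have le: "nm (A f) \<le> (1/4)^n * nm f"
      by (rule power2_le_imp_le) (simp add: f)
    have "nm ((1 / nm f) *\<^sub>R f) = 1"
      using nf by (simp add: nm_scale f)
    moreover have "nm (A ((1 / nm f) *\<^sub>R f)) \<le> (1/4)^n"
      using le nf by (simp add: d nm_scale f field_simps)
    ultimately show ?thesis using f by blast
  qed
  then obtain F where F: "\<And>n. F n \<in> H" "\<And>n. nm (F n) = 1" "\<And>n. nm (A (F n)) \<le> (1/4)^n"
    by metis
  \<comment> \<open>The sign prevents cancellation, so \<open>g (Suc n)\<close> pairs with
    \<open>F n\<close> to at least \<open>(1/3)^n\<close> in absolute value. The ratio 1/3 leaves a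
    tail of at most half that size, and it exceeds the decay rate 1/4 of
    \<open>A (F n)\<close>.\<close>
  define g where "g = rec_nat 0 (\<lambda>n v. v + ((if ip v (F n) \<ge> 0 then 1 else -1) * (1/3)^n) *\<^sub>R F n)"
  define t where "t n = ((if ip (g n) (F n) \<ge> 0 then 1 else -1) * (1/3)^n) *\<^sub>R F n" for n
  have g0: "g 0 = 0" and gS: "g (Suc n) = g n + t n" for n by (auto simp: g_def t_def)
  have tH: "t n \<in> H" for n by (simp add: t_def F)
  have gsum: "g n = sum t {..<n}" for n by (induction n) (auto simp: g0 gS)
  have gH: "g n \<in> H" for n by (simp add: gsum sum_H tH)
  have nt: "nm (t n) = (1/3)^n" for n by (simp add: t_def nm_scale F abs_mult)
  have "summable (\<lambda>n. nm (t n))" by (simp add: nt summable_geometric)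
  then obtain z where z: "z \<in> H" and zl: "(\<lambda>n. nm (z - g n)) \<longlonglongrightarrow> 0"
    unfolding gsum by (rule complete_nm[OF tH])
  have hump: "\<bar>ip (g (Suc n)) (F n)\<bar> \<ge> (1/3)^n" for n
    using gH[of n] F(1)[of n] nm_sq[OF F(1)[of n]] F(2)[of n]
    by (auto simp: gS t_def ip_simps)
  have tail: "nm (g (Suc n + j) - g (Suc n)) \<le> (1/2) * (1/3)^n * (1 - (1/3)^j)" for n j
  proof (induction j)
    case 0 show ?case using ip_scale[of 0 0 0] by (simp add: nm_def)
  next
    case (Suc j)
    have eq: "g (Suc n + Suc j) - g (Suc n) = (g (Suc n + j) - g (Suc n)) + t (Suc n + j)"
      by (simp add: gS)
    have "nm (g (Suc n + Suc j) - g (Suc n)) \<le> nm (g (Suc n + j) - g (Suc n)) + nm (t (Suc n + j))"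
      unfolding eq by (intro nm_triangle H_closed gH tH)
    also have "\<dots> \<le> (1/2) * (1/3)^n * (1 - (1/3)^j) + (1/3)^(Suc n + j)"
      using Suc nt by simp
    finally show ?case by (simp add: power_add field_simps)
  qed
  have zt: "nm (z - g (Suc n)) \<le> (1/2) * (1/3)^n" for n
  proof (rule LIMSEQ_le_const)
    show "(\<lambda>j. nm (z - g (j + Suc n)) + (1/2) * (1/3)^n) \<longlonglongrightarrow> 1/2 * (1/3)^n"
      using tendsto_add[OF LIMSEQ_ignore_initial_segment[OF zl, of "Suc n"] tendsto_const] by simp
    have "nm (z - g (Suc n)) \<le> nm (z - g (j + Suc n)) + (1/2) * (1/3)^n" for j
    proof -
      have eq: "z - g (Suc n) = (z - g (j + Suc n)) + (g (Suc n + j) - g (Suc n))"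
        by (simp add: add.commute)
      have "nm (z - g (Suc n)) \<le> nm (z - g (j + Suc n)) + nm (g (Suc n + j) - g (Suc n))"
        unfolding eq by (intro nm_triangle H_closed gH z)
      also have "nm (g (Suc n + j) - g (Suc n)) \<le> (1/2) * (1/3)^n"
        using tail[of n j] by (rule order_trans) simp
      finally show ?thesis by simp
    qed
    then show "\<exists>N. \<forall>j\<ge>N. nm (z - g (Suc n)) \<le> nm (z - g (j + Suc n)) + (1/2) * (1/3)^n" by blast
  qed
  obtain h where h: "h \<in> H" "nm (A h - z) = 0"
    using surj z by (auto simp: surjop_def)
  \<comment> \<open>Half of the hump survives in \<open>z\<close>, while a preimage \<open>h\<close>
    turns the pairing with \<open>F n\<close> into \<open>ip h (A (F n))\<close>.\<close>
  have key: "(1/2) * (1/3)^n \<le> nm h * (1/4)^n" for n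
  proof -
    have "\<bar>ip (z - g (Suc n)) (F n)\<bar> \<le> (1/2) * (1/3)^n"
      using ip_cs[of "z - g (Suc n)" "F n"] zt[of n] z gH F by (metis H_closed(3) mult.right_neutral order_trans)
    then have 1: "\<bar>ip z (F n)\<bar> \<ge> (1/2) * (1/3)^n"
      using hump[of n] unfolding ip_diff[OF z gH F(1)] by linarith
    have "ip (A h - z) (F n) = 0"
      using ip_cs[of "A h - z" "F n"] h z d F by simp
    then have "ip z (F n) = ip h (A (F n))"
      using h z d F by (simp add: ip_simps)
    then have "\<bar>ip z (F n)\<bar> \<le> nm h * nm (A (F n))"
      using ip_cs[of h "A (F n)"] h d F by simp
    also have "\<dots> \<le> nm h * (1/4)^n" by (intro mult_left_mono F) (simp add: h)
    finally show ?thesis using 1 by simp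
  qed
  have "(4/3)^n \<le> 2 * nm h" for n :: nat
    using key[of n] by (simp add: power_divide field_simps)
  moreover obtain n :: nat where "2 * nm h < (4/3)^n"
    using real_arch_pow[of "4/3" "2 * nm h"] by auto
  ultimately show False by (meson not_less)
qed

text \<open>A Neumann series: \<open>B = 1 - A/e\<close> has norm at most \<open>q < 1\<close>, so
  \<open>1/e\<close> times the sum of the iterates of \<open>B\<close> at \<open>g\<close> is a
  preimage of \<open>g\<close> up to norm zero.\<close>

lemma posop_bounded_below_imp_surj:
  assumes A: "posop c A" and \<delta>: "\<delta> > 0" and low: "\<And>f. f \<in> H \<Longrightarrow> \<delta> * ip f f \<le> ip (A f) f"
  shows "surjop A"
  unfolding surjop_def
proof
  fix g assume g: "g \<in> H"
  have s: "symop A" and c: "0 \<le> c" and up: "\<And>f. f \<in> H \<Longrightarrow> ip (A f) f \<le> c * ip f f"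
    using A by (auto simp: posop_def)
  note d = symopD[OF s]
  \<comment> \<open>Adding \<open>\<delta>\<close> keeps \<open>e\<close> positive even for
    \<open>c = 0\<close>, and \<open>q\<close> nonnegative.\<close>
  define e where "e = c + \<delta>"
  define q where "q = 1 - \<delta> / e"
  define B where "B f = f - (1/e) *\<^sub>R A f" for f
  have e: "e > 0" and q: "0 \<le> q" "q < 1" using c \<delta> by (auto simp: e_def q_def)
  have ipB: "ip (B f) f = ip f f - ip (A f) f / e" if "f \<in> H" for f
    using that by (simp add: B_def ip_simps d)
  have B: "posop q B"
    unfolding posop_def symop_def
  proof (intro conjI ballI allI)
    fix f assume f: "f \<in> H"
    have "ip (A f) f / e \<le> ip f f"
      using up[OF f] e \<delta> mult_nonneg_nonneg[OF less_imp_le[OF \<delta>] ip_nonneg[OF f]]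
      by (simp add: e_def field_simps)
    then show "0 \<le> ip (B f) f" by (simp add: ipB f)
    show "ip (B f) f \<le> q * ip f f"
      using low[OF f] e by (simp add: ipB f q_def field_simps)
  qed (use q in \<open>auto simp: B_def d ip_simps algebra_simps\<close>)
  then have BH: "\<And>f. f \<in> H \<Longrightarrow> B f \<in> H" by (auto simp: posop_def symop_def)
  define u where "u n = (B ^^ n) g" for n
  have uH: "u n \<in> H" for n by (induction n) (auto simp: u_def BH g)
  have nu: "nm (u n) \<le> q ^ n * nm g" for n
  proof (induction n)
    case 0 show ?case by (simp add: u_def)
  next
    case (Suc n)
    have "nm (u (Suc n)) \<le> q * nm (u n)" using posop_nm[OF B uH] by (simp add: u_def)
    also have "\<dots> \<le> q * (q ^ n * nm g)" using Suc q by (intro mult_left_mono) auto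
    finally show ?case by simp
  qed
  have "summable (\<lambda>n. nm (u n))"
    by (rule summable_comparison_test'[where g = "\<lambda>n. q ^ n * nm g" and N = 0])
      (use nu uH q in \<open>auto intro!: summable_mult2 summable_geometric\<close>)
  then obtain z where z: "z \<in> H" and zl: "(\<lambda>n. nm (z - sum u {..<n})) \<longlonglongrightarrow> 0"
    by (rule complete_nm[OF uH])
  let ?s = "\<lambda>n. sum u {..<n}"
  have sH: "?s n \<in> H" for n by (rule sum_H[OF uH])
  have tel: "?s n - B (?s n) = g - u n" for n
  proof (induction n)
    case 0 show ?case using symopD(3)[OF s, of 0 0] by (simp add: u_def B_def)
  next
    case (Suc n)
    have "B (?s n + u n) = B (?s n) + B (u n)"
      using B sH uH by (auto simp: posop_def symop_def)
    then show ?case using Suc by (simp add: u_def algebra_simps)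
  qed
  have "nm (A ((1/e) *\<^sub>R z) - g) \<le> nm (z - ?s n) + q * nm (z - ?s n) + q ^ n * nm g" for n
  proof -
    have "A ((1/e) *\<^sub>R z) - g = z - B z - g" by (simp add: B_def d z)
    also have "\<dots> = ((z - ?s n) - B (z - ?s n)) - u n"
    proof -
      have "B (z - ?s n) = B z - B (?s n)" using symop_diff[of B] B z sH by (simp add: posop_def)
      moreover have "g = ?s n - B (?s n) + u n" by (simp add: tel)
      ultimately show ?thesis by simp
    qed
    finally have eq: "A ((1/e) *\<^sub>R z) - g = ((z - ?s n) - B (z - ?s n)) - u n" .
    have "nm (A ((1/e) *\<^sub>R z) - g) \<le> nm ((z - ?s n) - B (z - ?s n)) + nm (u n)"
      unfolding eq by (intro nm_triangle_diff H_closed z sH uH BH)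
    also have "\<dots> \<le> nm (z - ?s n) + nm (B (z - ?s n)) + nm (u n)"
      using nm_triangle_diff z sH BH by (simp add: add_mono)
    also have "\<dots> \<le> nm (z - ?s n) + q * nm (z - ?s n) + q ^ n * nm g"
      using posop_nm[OF B, of "z - ?s n"] nu[of n] z sH by (simp add: add_mono)
    finally show ?thesis .
  qed
  moreover have "(\<lambda>n. nm (z - ?s n) + q * nm (z - ?s n) + q ^ n * nm g) \<longlonglongrightarrow> 0 + q * 0 + 0 * nm g"
    using q by (intro tendsto_intros zl LIMSEQ_power_zero) auto
  ultimately have "nm (A ((1/e) *\<^sub>R z) - g) \<le> 0"
    by (intro LIMSEQ_le_const[of "\<lambda>n. nm (z - ?s n) + q * nm (z - ?s n) + q ^ n * nm g"]) auto
  then show "\<exists>f\<in>H. nm (A f - g) = 0"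
    using z g nm_nonneg[of "A ((1/e) *\<^sub>R z) - g"] d(1)[of "(1/e) *\<^sub>R z"]
    by (intro bexI[of _ "(1/e) *\<^sub>R z"] antisym) auto
qed

text \<open>If the form inequality failed, the infimum \<open>I\<close> of \<open>\<parallel>(S - \<epsilon>/2) f\<parallel>\<^sup>2\<close> over unit vectors would be
  below \<open>\<epsilon>\<^sup>2/4\<close>, and \<open>(S - \<epsilon>/2)\<^sup>2 - I\<close> factors into two surjective operators \<open>S - (\<epsilon>/2 \<plusminus> \<surd>I)\<close>.\<close>
lemma gap_imp_form_ineq:
  assumes S: "posop c S" and eps: "\<epsilon> > 0"
    and surj: "\<And>\<mu>. 0 < \<mu> \<Longrightarrow> \<mu> < \<epsilon> \<Longrightarrow> surjop (\<lambda>f. S f - \<mu> *\<^sub>R f)"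
    and f0: "f0 \<in> H"
  shows "\<epsilon> * ip (S f0) f0 \<le> ip (S f0) (S f0)"
proof (rule ccontr)
  assume neg: "\<not> ?thesis"
  have s: "symop S" and c: "0 \<le> c" using S by (auto simp: posop_def)
  note d = symopD[OF s]
  \<comment> \<open>Completing the square: by \<open>RR\<close> below, the inequality for
    \<open>f\<close> says \<open>\<epsilon>\<^sup>2/4 * ip f f \<le> ip (R f) (R f)\<close>.\<close>
  define R where "R f = S f - (\<epsilon>/2) *\<^sub>R f" for f
  have RH: "R f \<in> H" if "f \<in> H" for f using that by (simp add: R_def d)
  have Rsc: "ip (R (a *\<^sub>R f)) (R (a *\<^sub>R f)) = a\<^sup>2 * ip (R f) (R f)" if "f \<in> H" for f a
  proof -
    have "R (a *\<^sub>R f) = a *\<^sub>R R f" using that by (simp add: R_def d algebra_simps)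
    then show ?thesis using RH[OF that] by (simp add: ip_simps power2_eq_square)
  qed
  have RR: "ip (R f) (R f) = ip (S f) (S f) - \<epsilon> * ip (S f) f + \<epsilon>\<^sup>2/4 * ip f f" if "f \<in> H" for f
    using that ip_sym[of f "S f"] by (simp add: R_def ip_simps d algebra_simps power2_eq_square)
  have lt: "ip (R f0) (R f0) < \<epsilon>\<^sup>2/4 * ip f0 f0" using neg by (simp add: RR f0)
  then have pos: "ip f0 f0 > 0"
    using ip_nonneg[OF RH[OF f0]] ip_nonneg[OF f0] by (cases "ip f0 f0 = 0") auto
  define V where "V = (\<lambda>f. ip (R f) (R f)) ` {f\<in>H. ip f f = 1}"
  define I where "I = Inf V"
  have V0: "v \<in> V \<Longrightarrow> 0 \<le> v" for v by (auto simp: V_def ip_nonneg RH)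
  then have bdd: "bdd_below V" by (intro bdd_belowI[of V 0])
  have unit: "ip (R f) (R f) / ip f f \<in> V" if f: "f \<in> H" "ip f f > 0" for f
  proof -
    let ?g = "(1 / sqrt (ip f f)) *\<^sub>R f"
    have 1: "(1 / sqrt (ip f f))\<^sup>2 = 1 / ip f f" using f by (simp add: power_divide)
    have "ip ?g ?g = (1 / sqrt (ip f f))\<^sup>2 * ip f f"
      using f(1) by (simp add: ip_simps power2_eq_square)
    then have "ip ?g ?g = 1" using f 1 by simp
    moreover have "ip (R ?g) (R ?g) = ip (R f) (R f) / ip f f"
      unfolding Rsc[OF f(1)] 1 by simp
    ultimately show ?thesis
      unfolding V_def using f by (intro image_eqI[of _ _ ?g]) auto
  qed
  have Ilt: "I < \<epsilon>\<^sup>2/4"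
  proof -
    have "I \<le> ip (R f0) (R f0) / ip f0 f0" unfolding I_def by (rule cInf_lower[OF unit[OF f0 pos] bdd])
    also have "\<dots> < \<epsilon>\<^sup>2/4" using lt pos by (simp add: field_simps)
    finally show ?thesis .
  qed
  have I0: "0 \<le> I" unfolding I_def using unit[OF f0 pos] V0 by (intro cInf_greatest) auto
  have Ile: "I * ip f f \<le> ip (R f) (R f)" if f: "f \<in> H" for f
  proof (cases "ip f f = 0")
    case True then show ?thesis by (simp add: ip_nonneg RH f)
  next
    case False
    then have p: "ip f f > 0" using ip_nonneg[OF f] by simp
    have "I \<le> ip (R f) (R f) / ip f f" unfolding I_def by (rule cInf_lower[OF unit[OF f p] bdd])
    then show ?thesis using p by (simp add: field_simps)
  qed
  \<comment> \<open>Since \<open>a < \<epsilon>/2\<close>, both \<open>\<epsilon>/2 - a\<close> and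
    \<open>\<epsilon>/2 + a\<close> lie strictly between 0 and \<open>\<epsilon>\<close>, where
    surjectivity is known.\<close>
  define a where "a = sqrt I"
  have a: "0 \<le> a" "a < \<epsilon>/2" and aa: "a * a = I"
    using I0 Ilt eps real_sqrt_less_mono[OF Ilt] by (auto simp: a_def real_sqrt_divide)
  define L where "L m f = S f - m *\<^sub>R f" for m f
  have LH: "L m f \<in> H" if "f \<in> H" for m f using that by (simp add: L_def d)
  have sL: "surjop (L (\<epsilon>/2 - a))" "surjop (L (\<epsilon>/2 + a))"
    using surj[of "\<epsilon>/2 - a"] surj[of "\<epsilon>/2 + a"] a by (auto simp: L_def[abs_def])
  define Q where "Q f = R (R f) - I *\<^sub>R f" for f
  have QH: "Q f \<in> H" if "f \<in> H" for f using that by (simp add: Q_def RH)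
  have QL: "Q f = L (\<epsilon>/2 - a) (L (\<epsilon>/2 + a) f)" if "f \<in> H" for f
    using that by (simp add: Q_def R_def L_def d symop_diff[OF s] algebra_simps flip: aa)
  have Rs: "symop R"
    unfolding symop_def by (auto simp: R_def d ip_simps algebra_simps)
  have ipQ: "ip (Q f) f = ip (R f) (R f) - I * ip f f" if "f \<in> H" for f
    using that RH by (simp add: Q_def ip_simps symopD(4)[OF Rs])
  have nR: "nm (R f) \<le> (c + \<epsilon>/2) * nm f" if f: "f \<in> H" for f
  proof -
    have "nm (R f) \<le> nm (S f) + nm ((\<epsilon>/2) *\<^sub>R f)"
      unfolding R_def by (intro nm_triangle_diff) (auto simp: d f)
    also have "\<dots> \<le> c * nm f + \<epsilon>/2 * nm f"
      using posop_nm[OF S f] eps by (simp add: nm_scale f)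
    finally show ?thesis by (simp add: algebra_simps)
  qed
  have "posop ((c + \<epsilon>/2)\<^sup>2) Q"
    unfolding posop_def
  proof (intro conjI ballI)
    show "symop Q" unfolding symop_def
      using symopD[OF Rs] by (auto simp: Q_def RH ip_simps algebra_simps)
    fix f assume f: "f \<in> H"
    show "0 \<le> ip (Q f) f" using Ile[OF f] by (simp add: ipQ f)
    have "(nm (R f))\<^sup>2 \<le> ((c + \<epsilon>/2) * nm f)\<^sup>2"
      by (intro power_mono nR f) (simp add: RH f)
    then have "ip (R f) (R f) \<le> (c + \<epsilon>/2)\<^sup>2 * ip f f"
      by (simp add: nm_sq power_mult_distrib RH f)
    then show "ip (Q f) f \<le> (c + \<epsilon>/2)\<^sup>2 * ip f f"
      using mult_nonneg_nonneg[OF I0 ip_nonneg[OF f]] unfolding ipQ[OF f] by linarith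
  qed simp
  moreover have "surjop Q"
    unfolding surjop_def
  proof
    fix g assume g: "g \<in> H"
    obtain h where h: "h \<in> H" "nm (L (\<epsilon>/2 - a) h - g) = 0" using sL(1) g by (auto simp: surjop_def)
    obtain f where f: "f \<in> H" "nm (L (\<epsilon>/2 + a) f - h) = 0" using sL(2) h by (auto simp: surjop_def)
    let ?w = "L (\<epsilon>/2 + a) f - h"
    have wH: "?w \<in> H" using f h LH by auto
    \<comment> \<open>Both preimages are correct only up to norm zero; boundedness of
      \<open>S\<close> carries the error \<open>?w\<close> through the outer factor.\<close>
    have eq: "Q f - g = L (\<epsilon>/2 - a) ?w + (L (\<epsilon>/2 - a) h - g)"
      using f h LH by (simp add: QL L_def d symop_diff[OF s] algebra_simps)
    have "nm (Q f - g) \<le> nm (L (\<epsilon>/2 - a) ?w)"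
      unfolding eq using nm_triangle[of "L (\<epsilon>/2 - a) ?w" "L (\<epsilon>/2 - a) h - g"] h g LH wH by auto
    also have "\<dots> \<le> nm (S ?w) + nm ((\<epsilon>/2 - a) *\<^sub>R ?w)"
      unfolding L_def[of "\<epsilon>/2 - a"] using wH by (intro nm_triangle_diff) (auto simp: d)
    also have "\<dots> \<le> c * nm ?w + \<bar>\<epsilon>/2 - a\<bar> * nm ?w"
      using posop_nm[OF S wH] by (simp add: nm_scale wH)
    also have "\<dots> = 0" using f by simp
    finally show "\<exists>f\<in>H. nm (Q f - g) = 0"
      using f g QH nm_nonneg[OF H_closed(3)[OF QH[OF f(1)] g]] by (intro bexI[of _ f] antisym) auto
  qed
  ultimately obtain \<delta> where \<delta>: "\<delta> > 0" "\<And>f. f \<in> H \<Longrightarrow> \<delta> * ip f f \<le> ip (Q f) f"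
    using posop_surj_imp_bounded_below by metis
  \<comment> \<open>Being positive and onto, \<open>Q\<close> is bounded below, which pushes the
    infimum strictly above itself.\<close>
  have "I + \<delta> \<le> Inf V"
  proof (rule cInf_greatest)
    show "V \<noteq> {}" using unit[OF f0 pos] by auto
    fix v assume "v \<in> V"
    then obtain f where f: "f \<in> H" "ip f f = 1" "v = ip (R f) (R f)" by (auto simp: V_def)
    then show "I + \<delta> \<le> v" using \<delta>(2)[of f] by (simp add: ipQ)
  qed
  then show False using \<delta> by (simp add: I_def)
qed

text \<open>The iterates of \<open>1 - S/c\<close> converge to the kernel of \<open>S\<close> with geometric rate in energy.\<close>
lemma form_ineq_imp_kernel_approx:
  assumes S: "posop c S" and c: "c > 0" and eps: "\<epsilon> > 0"
    and gap: "\<And>f. f \<in> H \<Longrightarrow> \<epsilon> * ip (S f) f \<le> ip (S f) (S f)"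
  obtains C where "C \<ge> 0" "\<And>f. f \<in> H \<Longrightarrow> \<exists>\<psi>\<in>H. nm (S \<psi>) = 0 \<and> (nm (f - \<psi>))\<^sup>2 \<le> C * ip (S f) f \<and>
      (\<forall>u\<in>H. nm (S u) = 0 \<longrightarrow> ip \<psi> u = ip f u)"
proof -
  have s: "symop S" and p: "\<And>f. f \<in> H \<Longrightarrow> 0 \<le> ip (S f) f"
    and up: "\<And>f. f \<in> H \<Longrightarrow> ip (S f) f \<le> c * ip f f"
    using S by (auto simp: posop_def)
  note d = symopD[OF s]
  \<comment> \<open>Keeping \<open>e\<close> below \<open>c\<close> makes \<open>q\<close> strictly
    positive.\<close>
  define e where "e = min \<epsilon> (c/2)"
  have e: "0 < e" "e < c" using eps c by (auto simp: e_def)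
  have gap': "e * ip (S f) f \<le> ip (S f) (S f)" if "f \<in> H" for f
    using gap[OF that] mult_right_mono[OF min.cobounded1 p[OF that], of \<epsilon> "c/2"] by (simp add: e_def)
  define q where "q = 1 - e/c"
  have q: "0 < q" "q < 1" using e c by (auto simp: q_def)
  \<comment> \<open>Energies shrink by the factor \<open>q\<close> per step, hence the norms of the
    increments by its square root.\<close>
  define r where "r = sqrt q"
  have r: "0 < r" "r < 1" using q by (auto simp: r_def)
  define B where "B f = f - (1/c) *\<^sub>R S f" for f
  have BH: "B f \<in> H" if "f \<in> H" for f using that by (simp add: B_def d)
  \<comment> \<open>The bound \<open>S \<le> c\<close>, applied to \<open>S g\<close>, lets the last
    term of the expansion absorb half of the middle one; the gap inequality turns the remaining half
    into the factor \<open>q\<close>.\<close>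
  have energy: "ip (S (B g)) (B g) \<le> q * ip (S g) g" if g: "g \<in> H" for g
  proof -
    have "ip (S (B g)) (B g) = ip (S g) g - 2/c * ip (S g) (S g) + 1/c\<^sup>2 * ip (S (S g)) (S g)"
      using g d(4)[of "S g" g] by (simp add: B_def d symop_diff[OF s] ip_simps diff_divide_distrib power2_eq_square)
    also have "\<dots> \<le> ip (S g) g - 2/c * ip (S g) (S g) + 1/c\<^sup>2 * (c * ip (S g) (S g))"
      using up[of "S g"] g by (intro add_left_mono mult_left_mono) (auto simp: d)
    also have "\<dots> = ip (S g) g - (1/c) * ip (S g) (S g)"
      using c by (simp add: field_simps power2_eq_square)
    also have "\<dots> \<le> ip (S g) g - (1/c) * (e * ip (S g) g)"
      using gap'[OF g] c by (simp add: divide_right_mono)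
    finally show ?thesis by (simp add: q_def algebra_simps)
  qed
  \<comment> \<open>The increments have norm at most \<open>K * r ^ n\<close> with
    \<open>K\<^sup>2 = ip (S f) f / c\<close>; \<open>C\<close> times the energy is the square of
    their total length \<open>K / (1 - r)\<close>.\<close>
  define C where "C = 1 / (c * (1 - r)\<^sup>2)"
  have "\<exists>\<psi>\<in>H. nm (S \<psi>) = 0 \<and> (nm (f - \<psi>))\<^sup>2 \<le> C * ip (S f) f \<and>
      (\<forall>u\<in>H. nm (S u) = 0 \<longrightarrow> ip \<psi> u = ip f u)" if f: "f \<in> H" for f
  proof -
    define b where "b n = (B ^^ n) f" for n
    have b0: "b 0 = f" and bS: "b (Suc n) = B (b n)" for n by (auto simp: b_def)
    have bH: "b n \<in> H" for n by (induction n) (auto simp: b0 bS BH f)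
    have eb: "ip (S (b n)) (b n) \<le> q ^ n * ip (S f) f" for n
    proof (induction n)
      case (Suc n)
      have "ip (S (b (Suc n))) (b (Suc n)) \<le> q * ip (S (b n)) (b n)" using energy[OF bH] by (simp add: bS)
      also have "\<dots> \<le> q * (q ^ n * ip (S f) f)" using Suc q by (intro mult_left_mono) auto
      finally show ?case by simp
    qed (simp add: b0)
    define K where "K = sqrt (ip (S f) f / c)"
    have K: "0 \<le> K" using p[OF f] c by (simp add: K_def)
    have nS: "nm (S (b n)) \<le> c * K * r ^ n" for n
    proof (rule power2_le_imp_le)
      have "(nm (S (b n)))\<^sup>2 \<le> c * ip (S (b n)) (b n)"
        using posop_sq[OF S bH] by (simp add: nm_sq d bH)
      also have "\<dots> \<le> c * (q ^ n * ip (S f) f)" using eb[of n] c by simp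
      also have "\<dots> = (c * K * r ^ n)\<^sup>2"
      proof -
        have "(r ^ n)\<^sup>2 = q ^ n" using q by (simp add: r_def power_mult[symmetric] mult.commute[of n] power_mult)
        moreover have "K\<^sup>2 = ip (S f) f / c" using p[OF f] c by (simp add: K_def)
        ultimately show ?thesis using c by (simp add: power_mult_distrib power2_eq_square[of c])
      qed
      finally show "(nm (S (b n)))\<^sup>2 \<le> (c * K * r ^ n)\<^sup>2" .
      show "0 \<le> c * K * r ^ n" using c K r by simp
    qed
    define t where "t n = b (Suc n) - b n" for n
    have tH: "t n \<in> H" for n by (simp add: t_def bH)
    have nt: "nm (t n) \<le> K * r ^ n" for n
    proof -
      have "t n = - ((1/c) *\<^sub>R S (b n))" by (simp add: t_def bS B_def)
      then have "nm (t n) = (1/c) * nm (S (b n))" using c by (simp add: nm_minus nm_scale d bH)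
      also have "\<dots> \<le> (1/c) * (c * K * r ^ n)" by (intro mult_left_mono nS) (use c in simp)
      finally show ?thesis using c by simp
    qed
    have "summable (\<lambda>n. nm (t n))"
      by (rule summable_comparison_test'[where g = "\<lambda>n. K * r ^ n" and N = 0])
        (use nt tH r in \<open>auto intro!: summable_mult summable_geometric\<close>)
    then obtain z where z: "z \<in> H" and zl: "(\<lambda>n. nm (z - sum t {..<n})) \<longlonglongrightarrow> 0"
      by (rule complete_nm[OF tH])
    have st: "sum t {..<n} = b n - f" for n by (induction n) (auto simp: t_def b0)
    define \<psi> where "\<psi> = f + z"
    have \<psi>: "\<psi> \<in> H" by (simp add: \<psi>_def f z)
    have lim: "(\<lambda>n. nm (\<psi> - b n)) \<longlonglongrightarrow> 0"
      using zl by (simp add: st \<psi>_def algebra_simps)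
    have rl: "(\<lambda>n. r ^ n) \<longlonglongrightarrow> 0" using r by (intro LIMSEQ_power_zero) auto
    have "nm (S \<psi>) \<le> c * nm (\<psi> - b n) + c * K * r ^ n" for n
    proof -
      have "S \<psi> = S (\<psi> - b n) + S (b n)" by (simp add: symop_diff[OF s] \<psi> bH)
      then have "nm (S \<psi>) \<le> nm (S (\<psi> - b n)) + nm (S (b n))"
        using nm_triangle[of "S (\<psi> - b n)" "S (b n)"] \<psi> bH d by auto
      also have "\<dots> \<le> c * nm (\<psi> - b n) + c * K * r ^ n"
        by (intro add_mono nS posop_nm[OF S]) (simp add: \<psi> bH)
      finally show ?thesis .
    qed
    moreover have "(\<lambda>n. c * nm (\<psi> - b n) + c * K * r ^ n) \<longlonglongrightarrow> c * 0 + c * K * 0"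
      by (intro tendsto_intros lim rl)
    ultimately have "nm (S \<psi>) \<le> 0"
      by (intro LIMSEQ_le_const[of "\<lambda>n. c * nm (\<psi> - b n) + c * K * r ^ n"]) auto
    then have S0: "nm (S \<psi>) = 0" using nm_nonneg[OF d(1)[OF \<psi>]] by linarith
    have fb: "nm (f - b n) \<le> K / (1 - r) * (1 - r ^ n)" for n
    proof (induction n)
      case 0 show ?case using ip_scale[of 0 0 0] by (simp add: nm_def b0)
    next
      case (Suc n)
      have eq: "f - b (Suc n) = (f - b n) - t n" by (simp add: t_def)
      have "nm (f - b (Suc n)) \<le> nm (f - b n) + nm (t n)"
        unfolding eq by (intro nm_triangle_diff H_closed f bH tH)
      also have "\<dots> \<le> K / (1 - r) * (1 - r ^ n) + K * r ^ n" using Suc nt[of n] by simp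
      also have "\<dots> = K / (1 - r) * (1 - r ^ Suc n)" using r by (simp add: field_simps)
      finally show ?case .
    qed
    have "nm (f - \<psi>) \<le> K / (1 - r) + nm (\<psi> - b n)" for n
    proof -
      have "f - \<psi> = (f - b n) - (\<psi> - b n)" by simp
      then have "nm (f - \<psi>) \<le> nm (f - b n) + nm (\<psi> - b n)"
        using nm_triangle_diff[of "f - b n" "\<psi> - b n"] f bH \<psi> by auto
      moreover have "K / (1 - r) * (1 - r ^ n) \<le> K / (1 - r)"
        using K r by (intro mult_left_le) auto
      ultimately show ?thesis using fb[of n] by simp
    qed
    moreover have "(\<lambda>n. K / (1 - r) + nm (\<psi> - b n)) \<longlonglongrightarrow> K / (1 - r) + 0"
      by (intro tendsto_intros lim)
    ultimately have "nm (f - \<psi>) \<le> K / (1 - r)"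
      by (intro LIMSEQ_le_const[of "\<lambda>n. K / (1 - r) + nm (\<psi> - b n)"]) auto
    then have "(nm (f - \<psi>))\<^sup>2 \<le> (K / (1 - r))\<^sup>2"
      by (intro power_mono) (auto simp: f \<psi>)
    also have "\<dots> = C * ip (S f) f"
      using p[OF f] c by (simp add: K_def C_def power_divide)
    finally have dist: "(nm (f - \<psi>))\<^sup>2 \<le> C * ip (S f) f" .
    \<comment> \<open>Each step subtracts a vector in the range of \<open>S\<close>, which is
      orthogonal to the kernel. Pairings with kernel vectors thus survive in the limit, and
      \<open>\<psi>\<close> is an orthogonal projection of \<open>f\<close>.\<close>
    have "ip \<psi> u = ip f u" if u: "u \<in> H" "nm (S u) = 0" for u
    proof -
      have "ip (S g) u = 0" if "g \<in> H" for g
        using ip_cs[of g "S u"] that u by (simp add: d)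
      then have bu: "ip (b n) u = ip f u" for n
        by (induction n) (auto simp: b0 bS B_def ip_simps bH d u)
      have "\<bar>ip \<psi> u - ip f u\<bar> \<le> nm (\<psi> - b n) * nm u" for n
        using ip_cs[of "\<psi> - b n" u] bu[of n] \<psi> bH u by (simp add: ip_simps)
      moreover have "(\<lambda>n. nm (\<psi> - b n) * nm u) \<longlonglongrightarrow> 0 * nm u"
        by (intro tendsto_intros lim)
      ultimately have "\<bar>ip \<psi> u - ip f u\<bar> \<le> 0"
        by (intro LIMSEQ_le_const[of "\<lambda>n. nm (\<psi> - b n) * nm u"]) auto
      then show ?thesis by simp
    qed
    then show ?thesis using \<psi> S0 dist by blast
  qed
  moreover have "C \<ge> 0" using c by (simp add: C_def)
  ultimately show thesis using that by blast
qed

end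

section \<open>Null sets and mass transport\<close>

lemma sets_pair_standard:
  fixes M :: "'a::polish_space measure"
  assumes "sets M = sets borel" shows "sets (M \<Otimes>\<^sub>M M) = sets borel"
  using sets_pair_measure_cong[OF assms assms] by (simp only: borel_prod)

text \<open>Here the spectrum replaces mass transport. Starting from the indicator of \<open>Z\<close>, monotone
  iteration gives a bounded \<open>F\<close> with \<open>T F = (d + 1) F\<close> off \<open>Z\<close> that is positive wherever a
  neighbour lies in \<open>Z\<close>; as \<open>d + 1\<close> is not an eigenvalue, \<open>F\<close> vanishes almost everywhere.\<close>
lemma null_sets_neighbours:
  fixes M :: "'a::polish_space measure"
  assumes M: "standard_prob_space M" and E: "{(x, y). E x y} \<in> sets borel"
    and Z: "Z \<in> null_sets M"
    and reg: "\<And>x. x \<notin> Z \<Longrightarrow> finite (neighbours E x) \<and> card (neighbours E x) = d"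
    and spec: "complex_of_real (real d + 1) \<notin> adjacency_spectrum M E"
  shows "{x. x \<notin> Z \<and> (\<exists>y\<in>Z. E x y)} \<in> null_sets M"
proof -
  interpret prob_space M using M by (simp add: standard_prob_space_def)
  have sets_M: "sets M = sets borel" using M by (simp add: standard_prob_space_def)
  have measurable_M: "borel_measurable M = (borel_measurable borel :: ('a \<Rightarrow> 'b::topological_space) set)"
    by (rule measurable_cong_sets) (simp_all add: sets_M)
  have Zb: "Z \<in> sets borel" "- Z \<in> sets borel" using Z using null_setsD2[OF Z] by (auto simp: sets_M intro: borel_comp)
  define T where "T f x = (if x \<in> - Z then \<Sum>y\<in>neighbours E x. f y else 0)" for f :: "'a \<Rightarrow> real" and x
  have Tm: "T f \<in> borel_measurable borel" if "f \<in> borel_measurable borel" for f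
  proof -
    have "(\<lambda>p::'a\<times>'a. f (snd p)) \<in> borel_measurable borel"
      by (rule measurable_compose[OF _ that]) (intro borel_measurable_continuous_onI continuous_intros)
    from neighbour_sum_measurable[OF Zb(2) E _ this, of d] reg
    show ?thesis by (simp add: T_def[abs_def] cong: if_cong)
  qed
  \<comment> \<open>On \<open>Z\<close> the value is 1, and off \<open>Z\<close> a sum of
    \<open>d\<close> values at most 1 is divided by \<open>d + 1\<close>; so the iterates stay in
    \<open>[0, 1]\<close>.\<close>
  define f where "f = rec_nat (indicator Z) (\<lambda>_ g x. indicator Z x + T g x / (real d + 1))"
  have f0: "f 0 = indicator Z" and fS: "f (Suc n) x = indicator Z x + T (f n) x / (real d + 1)" for n x
    by (simp_all add: f_def)
  have fm: "f n \<in> borel_measurable borel" for n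
  proof (induction n)
    case (Suc n)
    have "(\<lambda>x. indicator Z x + T (f n) x / (real d + 1)) \<in> borel_measurable borel"
      using Zb Tm[OF Suc] by simp
    moreover have "f (Suc n) = (\<lambda>x. indicator Z x + T (f n) x / (real d + 1))" by (simp add: fun_eq_iff fS)
    ultimately show ?case by simp
  qed (use Zb in \<open>simp add: f0\<close>)
  have bnd: "0 \<le> f n x \<and> f n x \<le> 1" for n x
  proof (induction n arbitrary: x)
    case (Suc n)
    show ?case
    proof (cases "x \<in> Z")
      case False
      have "(\<Sum>y\<in>neighbours E x. f n y) \<le> real (card (neighbours E x)) * 1"
        by (rule sum_bounded_above) (use Suc in auto)
      then show ?thesis using False reg[OF False] Suc by (simp add: fS T_def sum_nonneg field_simps)
    qed (simp add: fS T_def)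
  qed (simp add: f0)
  have inc: "f n x \<le> f (Suc n) x" for n x
  proof (induction n arbitrary: x)
    case 0
    then show ?case using bnd[of 0] by (simp add: fS T_def f0 sum_nonneg)
  next
    case (Suc n)
    have "(\<Sum>y\<in>neighbours E x. f n y) \<le> (\<Sum>y\<in>neighbours E x. f (Suc n) y)"
      by (rule sum_mono) (rule Suc)
    then show ?case unfolding fS[of "Suc n"] fS[of n x] by (simp add: T_def divide_right_mono)
  qed
  define F where "F x = lim (\<lambda>n. f n x)" for x
  have incs: "incseq (\<lambda>n. f n x)" for x using inc by (intro incseq_SucI)
  have lim: "(\<lambda>n. f n x) \<longlonglongrightarrow> F x" for x
  proof -
    have "\<exists>L. (\<lambda>n. f n x) \<longlonglongrightarrow> L"
      by (rule incseq_convergent[OF incs[of x], of 1]) (use bnd in auto)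
    then obtain L where "(\<lambda>n. f n x) \<longlonglongrightarrow> L" ..
    then show ?thesis by (simp add: F_def limI)
  qed
  have Fge: "f n x \<le> F x" for n x using incseq_le[OF incs lim] by blast
  have F01: "0 \<le> F x" "F x \<le> 1" for x
    using Fge[of 0 x] bnd[of 0 x] LIMSEQ_le_const2[OF lim, of x 1] bnd by fastforce+
  have Fm: "F \<in> borel_measurable M" unfolding measurable_M by (rule borel_measurable_LIMSEQ_real[OF lim fm])
  have eig: "(\<Sum>y\<in>neighbours E x. F y) = (real d + 1) * F x" if "x \<notin> Z" for x
  proof -
    have "(\<lambda>n. f (Suc n) x) \<longlonglongrightarrow> (\<Sum>y\<in>neighbours E x. F y) / (real d + 1)"
      using that by (simp add: fS T_def, intro tendsto_intros lim) auto
    then have "F x = (\<Sum>y\<in>neighbours E x. F y) / (real d + 1)"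
      using LIMSEQ_unique LIMSEQ_Suc[OF lim] by blast
    then show ?thesis by (simp add: field_simps)
  qed
  have AEZ: "AE x in M. x \<notin> Z" using Z by (rule AE_not_in)
  have "(\<lambda>x. complex_of_real (F x)) \<in> L2 M"
    unfolding L2_def
  proof (intro CollectI conjI)
    show "(\<lambda>x. complex_of_real (F x)) \<in> borel_measurable M" using Fm by simp
    show "integrable M (\<lambda>x. (cmod (complex_of_real (F x)))\<^sup>2)"
      by (rule integrable_const_bound[where B = 1]) (use F01 Fm in \<open>auto simp: power_le_one abs_le_iff\<close>)
  qed
  moreover have "AE x in M. adjacency_op E (\<lambda>x. complex_of_real (F x)) x -
      complex_of_real (real d + 1) * complex_of_real (F x) = 0"
    using AEZ by eventually_elim (simp add: adjacency_op_def eig flip: of_real_sum)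
  ultimately have "AE x in M. complex_of_real (F x) = 0"
    using spec unfolding adjacency_spectrum_def by blast
  then have "AE x in M. F x = 0" by simp
  then have AE: "AE x in M. x \<notin> {x. x \<notin> Z \<and> (\<exists>y\<in>Z. E x y)}"
  proof eventually_elim
    case (elim x)
    show ?case
    proof
      assume "x \<in> {x. x \<notin> Z \<and> (\<exists>y\<in>Z. E x y)}"
      then obtain y where y: "x \<notin> Z" "y \<in> Z" "y \<in> neighbours E x" by (auto simp: neighbours_def)
      \<comment> \<open>\<open>F\<close> is at least 1 on \<open>Z\<close>, so a neighbour in
        \<open>Z\<close> keeps \<open>F x\<close> from vanishing.\<close>
      have "F y \<le> (\<Sum>y\<in>neighbours E x. F y)"
        by (rule member_le_sum) (use y reg F01 in auto)
      then have "F y \<le> 0" using eig[OF y(1)] elim by simp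
      then show False using Fge[of 0 y] y by (simp add: f0)
    qed
  qed
  \<comment> \<open>The statement with \<open>AE\<close> only puts the set inside a null set; its
    measurability comes from a neighbour sum.\<close>
  have "{x. x \<notin> Z \<and> (\<exists>y\<in>Z. E x y)} = {x. T (indicator Z) x \<noteq> 0}"
  proof -
    have "(\<Sum>y\<in>neighbours E x. indicator Z y :: real) = 0 \<longleftrightarrow> \<not> (\<exists>y\<in>Z. E x y)" if "x \<notin> Z" for x
      using reg[OF that] by (subst sum_nonneg_eq_0_iff) (auto simp: neighbours_def indicator_def)
    then show ?thesis by (auto simp: T_def)
  qed
  moreover have "{x. T (indicator Z) x \<noteq> 0} \<in> sets M"
  proof -
    have "T (indicator Z) -` (- {0}) \<inter> space borel \<in> sets borel"
      by (rule measurable_sets[OF Tm]) (use Zb in auto)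
    moreover have "T (indicator Z) -` (- {0}) = {x. T (indicator Z) x \<noteq> 0}" by auto
    ultimately show ?thesis by (simp add: sets_M)
  qed
  ultimately have "{x. x \<notin> Z \<and> (\<exists>y\<in>Z. E x y)} \<in> sets M" by simp
  then show ?thesis using AE by (simp add: AE_iff_null_sets)
qed

text \<open>Countably many applications of \<open>null_sets_neighbours\<close>. Every stage contains
  \<open>Z0\<close>, so regularity outside the current set persists as the set grows.\<close>

lemma null_sets_edge_closure:
  fixes M :: "'a::polish_space measure"
  assumes M: "standard_prob_space M" and E: "{(x, y). E x y} \<in> sets borel"
    and Z0: "Z0 \<in> null_sets M"
    and reg: "\<And>x. x \<notin> Z0 \<Longrightarrow> finite (neighbours E x) \<and> card (neighbours E x) = d"
    and spec: "complex_of_real (real d + 1) \<notin> adjacency_spectrum M E"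
  obtains Z where "Z \<in> null_sets M" "Z0 \<subseteq> Z" "\<And>x y. x \<notin> Z \<Longrightarrow> E x y \<Longrightarrow> y \<notin> Z"
proof -
  define Z where "Z = rec_nat Z0 (\<lambda>_ Y. Y \<union> {x. x \<notin> Y \<and> (\<exists>y\<in>Y. E x y)})"
  have Z_0: "Z 0 = Z0" and Z_S: "Z (Suc n) = Z n \<union> {x. x \<notin> Z n \<and> (\<exists>y\<in>Z n. E x y)}" for n
    by (simp_all add: Z_def)
  have "Z n \<in> null_sets M \<and> Z0 \<subseteq> Z n" for n
  proof (induction n)
    case (Suc n)
    have "{x. x \<notin> Z n \<and> (\<exists>y\<in>Z n. E x y)} \<in> null_sets M"
      by (rule null_sets_neighbours[OF M E _ _ spec]) (use Suc reg in auto)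
    then show ?case using Suc by (auto simp: Z_S)
  qed (simp add: Z_0 Z0)
  then have "(\<Union>n. Z n) \<in> null_sets M" "Z0 \<subseteq> (\<Union>n. Z n)" by (blast intro: null_sets_UN)+
  moreover have "y \<notin> (\<Union>n. Z n)" if "x \<notin> (\<Union>n. Z n)" "E x y" for x y
  proof
    assume "y \<in> (\<Union>n. Z n)"
    then obtain n where "y \<in> Z n" by blast
    then have "x \<in> Z (Suc n)" using that(2) by (auto simp: Z_S)
    then show False using that(1) by blast
  qed
  ultimately show thesis using that by blast
qed

text \<open>\<open>X\<close> is what remains of the vertex set once a null set has been discarded.\<close>
locale conull_regular_graph =
  fixes M :: "'a::polish_space measure" and E :: "'a \<Rightarrow> 'a \<Rightarrow> bool" and d :: nat and X :: "'a set"
  assumes std: "standard_prob_space M"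
    and graph: "borel_graph M E"
    and pmp: "pmp_graph M E"
    and X: "X \<in> sets M" and conull: "AE x in M. x \<in> X"
    and reg: "x \<in> X \<Longrightarrow> finite (neighbours E x) \<and> card (neighbours E x) = d"
    and closed: "x \<in> X \<Longrightarrow> E x y \<Longrightarrow> y \<in> X"
begin

sublocale prob_space M using std by (simp add: standard_prob_space_def)

lemma sets_M: "sets M = sets borel" using std by (simp add: standard_prob_space_def)
lemma space_M: "space M = UNIV" using sets_eq_imp_space_eq[OF sets_M] by simp
lemma measurable_M: "borel_measurable M = (borel_measurable borel :: ('a \<Rightarrow> 'b::topological_space) set)"
  by (rule measurable_cong_sets) (simp_all add: sets_M)
lemma E_sym: "E x y \<Longrightarrow> E y x" using graph by (auto simp: borel_graph_def)
lemma E_borel: "{(x, y). E x y} \<in> sets borel"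
  using graph sets_pair_standard[OF sets_M] by (simp add: borel_graph_def)
lemma X_borel: "X \<in> sets borel" using X by (simp add: sets_M)
lemma fin_nb: "x \<in> X \<Longrightarrow> finite (neighbours E x)" using reg by blast
text \<open>The summand depends on the directed edge, so that mass transport becomes an exchange of
  end points. The value 0 off \<open>X\<close> disposes of vertices whose neighbour sets may be
  infinite.\<close>

definition nsum :: "('a \<times> 'a \<Rightarrow> 'c::comm_monoid_add) \<Rightarrow> 'a \<Rightarrow> 'c" where
  "nsum F x = (if x \<in> X then \<Sum>y\<in>neighbours E x. F (x, y) else 0)"

lemma nsum_measurable:
  fixes F :: "'a \<times> 'a \<Rightarrow> 'c::{second_countable_topology, topological_comm_monoid_add}"
  assumes "F \<in> borel_measurable borel" shows "nsum F \<in> borel_measurable M"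
  using neighbour_sum_measurable[OF X_borel E_borel reg assms] by (simp add: measurable_M nsum_def[abs_def])

section \<open>Borel sets of edges and mass transport\<close>

definition edge_set :: "('a \<times> 'a) set" where "edge_set = {(x, y). E x y \<and> x \<in> X}"

lemma swap_measurable: "prod.swap \<in> measurable (borel :: ('a \<times> 'a) measure) (borel :: ('a \<times> 'a) measure)"
  by (rule borel_measurable_continuous_onI) (rule continuous_on_swap)

lemma swap_borel:
  assumes "W \<in> sets (borel :: ('a \<times> 'a) measure)" shows "prod.swap ` W \<in> sets borel"
proof -
  have "prod.swap -` W \<in> sets borel" using measurable_sets[OF swap_measurable assms] by simp
  moreover have "prod.swap ` W = prod.swap -` W" by force
  ultimately show ?thesis by simp
qed

lemma swap_edge_set: "W \<subseteq> edge_set \<Longrightarrow> prod.swap ` W \<subseteq> edge_set"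
  using closed E_sym by (force simp: edge_set_def)

lemma edge_set_borel: "edge_set \<in> sets borel"
proof -
  have "(fst :: 'a \<times> 'a \<Rightarrow> 'a) \<in> borel_measurable borel"
    by (intro borel_measurable_continuous_onI continuous_intros)
  from measurable_sets[OF this X_borel] have "fst -` X \<in> sets (borel :: ('a \<times> 'a) measure)" by simp
  moreover have "edge_set = {(x, y). E x y} \<inter> fst -` X" by (auto simp: edge_set_def)
  ultimately show ?thesis using E_borel by simp
qed

lemma rect_borel: "A \<in> sets borel \<Longrightarrow> B \<in> sets borel \<Longrightarrow> A \<times> B \<in> sets (borel :: ('a \<times> 'a) measure)"
  by (metis borel_prod pair_measureI)

text \<open>Projections of Borel sets need not be Borel, but here the fibres are finite: a vertex
  belongs to the projection iff its number of \<open>W\<close>-edges, a measurable function, is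
  nonzero.\<close>

lemma fst_borel:
  assumes W: "W \<in> sets borel" "W \<subseteq> edge_set" shows "fst ` W \<in> sets M"
proof -
  have "fst ` W = {x. nsum (indicator W :: _ \<Rightarrow> real) x \<noteq> 0}"
  proof -
    have "(\<Sum>y\<in>neighbours E x. indicator W (x, y) :: real) = 0 \<longleftrightarrow> x \<notin> fst ` W" if "x \<in> X" for x
      using fin_nb[OF that] W(2)
      by (subst sum_nonneg_eq_0_iff) (force simp: edge_set_def neighbours_def indicator_def)+
    then show ?thesis using W(2) by (auto simp: nsum_def edge_set_def split: if_splits)
  qed
  also have "\<dots> = nsum (indicator W :: _ \<Rightarrow> real) -` (- {0}) \<inter> space M" by (auto simp: space_M)
  also have "\<dots> \<in> sets M" by (rule measurable_sets[OF nsum_measurable]) (use W in auto)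
  finally show ?thesis .
qed

lemma snd_borel:
  assumes W: "W \<in> sets borel" "W \<subseteq> edge_set" shows "snd ` W \<in> sets M"
proof -
  have "snd ` W = fst ` (prod.swap ` W)" by force
  then show ?thesis using fst_borel[OF swap_borel swap_edge_set] W by simp
qed

text \<open>These are the graphs of partial injections.\<close>

definition biunique :: "('a \<times> 'a) set \<Rightarrow> bool" where
  "biunique W \<longleftrightarrow> (\<forall>p\<in>W. \<forall>q\<in>W. fst p = fst q \<or> snd p = snd q \<longrightarrow> p = q)"

text \<open>\<open>pmp_graph\<close> applies to the partial injection with graph \<open>W\<close>:
  end points of an edge are connected, and images and preimages of Borel sets are projections of
  Borel sets of edges.\<close>

lemma emeasure_biunique:
  assumes W: "W \<in> sets borel" "W \<subseteq> edge_set" "biunique W"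
  shows "emeasure M (snd ` W) = emeasure M (fst ` W)"
proof -
  define f where "f x = (THE y. (x, y) \<in> W)" for x
  have f: "f x = y" if "(x, y) \<in> W" for x y
    using that W(3) unfolding f_def biunique_def by (intro the_equality) force+
  have fW: "(x, f x) \<in> W" if "x \<in> fst ` W" for x using that f by force
  have im: "f ` B = snd ` (W \<inter> B \<times> UNIV)" if "B \<subseteq> fst ` W" for B
  proof (intro equalityI subsetI)
    fix y assume "y \<in> f ` B"
    then obtain x where x: "x \<in> B" "y = f x" by blast
    then have "(x, y) \<in> W \<inter> B \<times> UNIV" using fW that by blast
    then show "y \<in> snd ` (W \<inter> B \<times> UNIV)" by (rule rev_image_eqI) simp
  next
    fix y assume "y \<in> snd ` (W \<inter> B \<times> UNIV)"
    then obtain x where "(x, y) \<in> W" "x \<in> B" by auto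
    then show "y \<in> f ` B" using f by blast
  qed
  have "partial_borel_bijection M (fst ` W) f"
    unfolding partial_borel_bijection_def
  proof (intro conjI ballI impI)
    show "fst ` W \<in> sets M" using W by (intro fst_borel)
    show "inj_on f (fst ` W)"
    proof (rule inj_onI)
      fix x y assume "x \<in> fst ` W" "y \<in> fst ` W" "f x = f y"
      then have "(x, f x) \<in> W" "(y, f x) \<in> W" using fW by metis+
      then show "x = y" using W(3) by (force simp: biunique_def)
    qed
    show "f ` fst ` W \<subseteq> space M" by (simp add: space_M)
    fix C assume C: "C \<in> sets M"
    have "f -` C \<inter> fst ` W = fst ` (W \<inter> UNIV \<times> C)"
    proof (intro equalityI subsetI)
      fix x assume "x \<in> f -` C \<inter> fst ` W"
      then have "(x, f x) \<in> W \<inter> UNIV \<times> C" using fW by auto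
      then show "x \<in> fst ` (W \<inter> UNIV \<times> C)" by (rule rev_image_eqI) simp
    next
      fix x assume "x \<in> fst ` (W \<inter> UNIV \<times> C)"
      then obtain y where "(x, y) \<in> W" "y \<in> C" by auto
      then show "x \<in> f -` C \<inter> fst ` W" using f by force
    qed
    moreover have "W \<inter> UNIV \<times> C \<in> sets borel"
      using W(1) rect_borel[of UNIV C] C by (auto simp: sets_M)
    ultimately show "f -` C \<inter> fst ` W \<in> sets M" using fst_borel W(2) by (metis inf.coboundedI1)
  next
    fix B assume B: "B \<in> sets M" "B \<subseteq> fst ` W"
    have "W \<inter> B \<times> UNIV \<in> sets borel"
      using W(1) rect_borel[of B UNIV] B by (auto simp: sets_M)
    then show "f ` B \<in> sets M" using snd_borel W(2) im[OF B(2)] by (metis inf.coboundedI1)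
  qed
  moreover have "connected_rel E x (f x)" if "x \<in> fst ` W" for x
    using fW[OF that] W(2) by (auto simp: edge_set_def)
  ultimately have "emeasure M (f ` (fst ` W)) = emeasure M (fst ` W)"
    using pmp fst_borel[OF W(1,2)] unfolding pmp_graph_def by blast
  moreover have "W \<inter> fst ` W \<times> UNIV = W" by force
  ultimately show ?thesis using im[of "fst ` W"] by simp
qed

lemma biunique_swap: "biunique W \<Longrightarrow> biunique (prod.swap ` W)"
  unfolding biunique_def by (metis (no_types, lifting) fst_swap imageE snd_swap swap_swap)

text \<open>Edges isolated from the other edges at either end by basic open sets.\<close>
lemma biunique_cover:
  obtains K :: "nat \<Rightarrow> ('a \<times> 'a) set"
  where "\<And>k. K k \<in> sets borel" "\<And>k. biunique (K k)" "(\<Union>k. K k) = edge_set"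
proof -
  obtain A :: "'a set set" where A: "countable A" "topological_basis A"
    using ex_countable_basis by blast
  have "A \<noteq> {}"
    using topological_basisE[OF A(2), of UNIV undefined] by (metis empty_iff open_UNIV UNIV_I)
  define U where "U = from_nat_into A"
  have UA: "U n \<in> A" for n using \<open>A \<noteq> {}\<close> by (simp add: U_def from_nat_into)
  have U: "open (U n)" for n using topological_basis_open[OF A(2)] UA by blast
  define a where "a n = {x. nsum (indicator (UNIV \<times> U n) :: _ \<Rightarrow> real) x = 1}" for n
  have aB: "a n \<in> sets borel" for n
  proof -
    have "UNIV \<times> U n \<in> sets (borel :: ('a \<times> 'a) measure)" using U by (intro rect_borel) auto
    then have "nsum (indicator (UNIV \<times> U n) :: _ \<Rightarrow> real) -` {1} \<inter> space M \<in> sets M"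
      by (intro measurable_sets[OF nsum_measurable]) auto
    moreover have "nsum (indicator (UNIV \<times> U n) :: _ \<Rightarrow> real) -` {1} = a n" by (auto simp: a_def)
    ultimately show ?thesis by (simp add: space_M sets_M)
  qed
  have a: "x \<in> a n \<longleftrightarrow> x \<in> X \<and> card (neighbours E x \<inter> U n) = 1" for x n
  proof (cases "x \<in> X")
    case True
    have "nsum (indicator (UNIV \<times> U n) :: _ \<Rightarrow> real) x = (\<Sum>y\<in>neighbours E x. indicator (U n) y)"
      using True by (simp add: nsum_def indicator_def)
    also have "\<dots> = real (card (neighbours E x \<inter> U n))"
      using fin_nb[OF True] by (simp add: indicator_def flip: sum.inter_restrict)
    finally show ?thesis using True by (simp add: a_def)
  qed (simp add: a_def nsum_def)
  \<comment> \<open>For such an edge \<open>(x, y)\<close>, \<open>y\<close> is the only neighbour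
    of \<open>x\<close> in \<open>U n\<close> and \<open>x\<close> the only neighbour of
    \<open>y\<close> in \<open>U m\<close>.\<close>
  define K where "K k = (case prod_decode k of (n, m) \<Rightarrow> edge_set \<inter> (a n \<inter> U m) \<times> (a m \<inter> U n))" for k
  show thesis
  proof (rule that)
    show "K k \<in> sets borel" for k
      using edge_set_borel aB U by (auto simp: K_def split: prod.split intro!: sets.Int rect_borel)
    have uniq: "y = y'" if "x \<in> a n" "E x y" "E x y'" "y \<in> U n" "y' \<in> U n" for x y y' n
    proof -
      have "card (neighbours E x \<inter> U n) = 1" "y \<in> neighbours E x \<inter> U n" "y' \<in> neighbours E x \<inter> U n"
        using that by (auto simp: a neighbours_def)
      then show ?thesis by (metis card_1_singletonE singletonD)
    qed
    show "biunique (K k)" for k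
    proof (cases "prod_decode k")
      case (Pair n m)
      show ?thesis
        unfolding biunique_def K_def Pair using uniq E_sym by (auto simp: edge_set_def)
    qed
    have sep: "\<exists>n. y \<in> U n \<and> x \<in> a n" if "x \<in> X" "E x y" for x y
    proof -
      \<comment> \<open>The finitely many other neighbours form a closed set, so a basic open set
        around \<open>y\<close> misses them.\<close>
      have "open (- (neighbours E x - {y}))"
        using fin_nb[OF that(1)] by (intro open_Compl finite_imp_closed finite_Diff)
      then obtain B where B: "B \<in> A" "y \<in> B" "B \<subseteq> - (neighbours E x - {y})"
        using topological_basisE[OF A(2), of _ y] by blast
      obtain n where n: "U n = B" using from_nat_into_surj[OF A(1) B(1)] by (auto simp: U_def)
      have "neighbours E x \<inter> U n = {y}" using B n that by (auto simp: neighbours_def)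
      then show ?thesis using B n that(1) by (auto simp: a)
    qed
    show "(\<Union>k. K k) = edge_set"
    proof (intro equalityI subsetI)
      fix p assume "p \<in> edge_set"
      then obtain x y where p: "p = (x, y)" "x \<in> X" "E x y" by (auto simp: edge_set_def)
      obtain n where "y \<in> U n" "x \<in> a n" using sep p by blast
      moreover obtain m where "x \<in> U m" "y \<in> a m" using sep[of y x] p E_sym closed by blast
      ultimately have "p \<in> K (prod_encode (n, m))" using p by (simp add: K_def edge_set_def)
      then show "p \<in> (\<Union>k. K k)" by blast
    next
      fix p assume "p \<in> (\<Union>k. K k)"
      then obtain k where "p \<in> K k" by blast
      then show "p \<in> edge_set" by (cases "prod_decode k") (simp add: K_def)
    qed
  qed
qed

lemma nn_integral_nsum_biunique:
  assumes W: "W \<in> sets borel" "W \<subseteq> edge_set" "biunique W"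
  shows "(\<integral>\<^sup>+x. nsum (indicator W) x \<partial>M) = emeasure M (fst ` W)"
proof -
  have "nsum (indicator W) x = (indicator (fst ` W) x :: ennreal)" for x
  proof (cases "x \<in> fst ` W")
    case True
    then obtain y where y: "(x, y) \<in> W" by auto
    then have xy: "x \<in> X" "y \<in> neighbours E x" using W(2) by (auto simp: edge_set_def neighbours_def)
    have "indicator W (x, z) = (indicator {y} z :: ennreal)" for z
      using y W(3) by (force simp: biunique_def indicator_def)
    then show ?thesis using xy True fin_nb by (simp add: nsum_def indicator_def sum.delta)
  next
    case False
    then have "indicator W (x, y) = (0 :: ennreal)" for y by (force simp: indicator_def)
    then show ?thesis using False by (simp add: nsum_def)
  qed
  then show ?thesis using fst_borel[OF W(1,2)] by simp
qed

text \<open>Cut the edges into disjoint biunique Borel pieces. On each piece the two integrals are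
  the measures of its two projections, which agree by \<open>emeasure_biunique\<close>.\<close>

lemma nn_integral_nsum_swap_set:
  assumes W: "W \<in> sets borel"
  shows "(\<integral>\<^sup>+x. nsum (indicator W) x \<partial>M) = (\<integral>\<^sup>+x. nsum (indicator (prod.swap ` W)) x \<partial>M)"
proof -
  obtain K :: "nat \<Rightarrow> ('a \<times> 'a) set"
    where K: "\<And>k. K k \<in> sets borel" "\<And>k. biunique (K k)" "(\<Union>k. K k) = edge_set"
    by (rule biunique_cover) blast
  define D where "D = disjointed K"
  have D: "D k \<in> sets borel" "D k \<subseteq> K k" for k
    using sets.range_disjointed_sets[of K borel] K(1) disjointed_subset[of K k] by (auto simp: D_def)
  have UD: "(\<Union>k. D k) = edge_set" using K(3) by (simp add: D_def UN_disjointed_eq)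
  have dD: "disjoint_family D" by (simp add: D_def disjoint_family_disjointed)
  \<comment> \<open>Any partition \<open>Q\<close> is allowed because this is used for
    \<open>D\<close> and for its mirror image.\<close>
  have main: "(\<integral>\<^sup>+x. nsum (indicator V) x \<partial>M) = (\<Sum>k. \<integral>\<^sup>+x. nsum (indicator (V \<inter> Q k)) x \<partial>M)"
    if V: "V \<in> sets borel" and Q: "\<And>k. Q k \<in> sets borel" "(\<Union>k. Q k) = edge_set" "disjoint_family Q"
    for V and Q :: "nat \<Rightarrow> ('a \<times> 'a) set"
  proof -
    have "nsum (indicator V) x = (\<Sum>k. nsum (indicator (V \<inter> Q k)) x :: ennreal)" for x
    proof (cases "x \<in> X")
      case True
      have "indicator V (x, y) = (\<Sum>k. indicator (V \<inter> Q k) (x, y) :: ennreal)" if "y \<in> neighbours E x" for y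
      proof -
        have "disjoint_family (\<lambda>k. V \<inter> Q k)" using Q(3) by (auto simp: disjoint_family_on_def)
        then have "(\<Sum>k. indicator (V \<inter> Q k) (x, y) :: ennreal) = indicator (\<Union>k. V \<inter> Q k) (x, y)"
          by (rule suminf_indicator)
        also have "(\<Union>k. V \<inter> Q k) = V \<inter> edge_set" using Q(2) by blast
        also have "indicator (V \<inter> edge_set) (x, y) = (indicator V (x, y) :: ennreal)"
          using True that by (auto simp: edge_set_def neighbours_def indicator_def)
        finally show ?thesis by simp
      qed
      then show ?thesis using True by (simp add: nsum_def suminf_sum)
    qed (simp add: nsum_def)
    then have "(\<integral>\<^sup>+x. nsum (indicator V) x \<partial>M) = (\<integral>\<^sup>+x. (\<Sum>k. nsum (indicator (V \<inter> Q k)) x) \<partial>M)" by simp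
    also have "\<dots> = (\<Sum>k. \<integral>\<^sup>+x. nsum (indicator (V \<inter> Q k)) x \<partial>M)"
      by (intro nn_integral_suminf nsum_measurable) (use V Q in auto)
    finally show ?thesis .
  qed
  have sub: "W \<inter> D k \<subseteq> edge_set" "W \<inter> D k \<in> sets borel" "biunique (W \<inter> D k)" for k
  proof -
    show "W \<inter> D k \<subseteq> edge_set" using UD by blast
    show "W \<inter> D k \<in> sets borel" using D W by blast
    show "biunique (W \<inter> D k)" using K(2)[of k] D(2)[of k] unfolding biunique_def by blast
  qed
  have "(\<integral>\<^sup>+x. nsum (indicator (prod.swap ` W)) x \<partial>M)
      = (\<Sum>k. \<integral>\<^sup>+x. nsum (indicator (prod.swap ` W \<inter> prod.swap ` D k)) x \<partial>M)"
  proof (rule main)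
    show "(\<Union>k. prod.swap ` D k) = edge_set"
    proof -
      have "(\<Union>k. prod.swap ` D k) = prod.swap ` edge_set" using UD by blast
      moreover have "edge_set \<subseteq> prod.swap ` edge_set"
        using image_mono[OF swap_edge_set[of edge_set], of prod.swap] by (simp add: image_comp)
      ultimately show ?thesis using swap_edge_set[of edge_set] by simp
    qed
    show "disjoint_family (\<lambda>k. prod.swap ` D k)" using dD by (fastforce simp: disjoint_family_on_def)
  qed (intro swap_borel W D)+
  also have "\<dots> = (\<Sum>k. \<integral>\<^sup>+x. nsum (indicator (W \<inter> D k)) x \<partial>M)"
  proof -
    have "(\<integral>\<^sup>+x. nsum (indicator (prod.swap ` W \<inter> prod.swap ` D k)) x \<partial>M)
        = (\<integral>\<^sup>+x. nsum (indicator (W \<inter> D k)) x \<partial>M)" for k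
    proof -
      have "prod.swap ` W \<inter> prod.swap ` D k = prod.swap ` (W \<inter> D k)"
        by (simp add: image_Int)
      moreover have "fst ` prod.swap ` (W \<inter> D k) = snd ` (W \<inter> D k)" by (simp add: image_comp comp_def)
      ultimately show ?thesis
        using nn_integral_nsum_biunique[OF sub(2,1,3)] emeasure_biunique[OF sub(2,1,3)]
          nn_integral_nsum_biunique[OF swap_borel swap_edge_set biunique_swap, OF sub(2,1,3)] by simp
    qed
    then show ?thesis by simp
  qed
  also have "\<dots> = (\<integral>\<^sup>+x. nsum (indicator W) x \<partial>M)" using main[OF W D(1) UD dD] by simp
  finally show ?thesis by simp
qed

theorem mass_transport:
  fixes F :: "'a \<times> 'a \<Rightarrow> ennreal"
  assumes "F \<in> borel_measurable borel"
  shows "(\<integral>\<^sup>+x. nsum F x \<partial>M) = (\<integral>\<^sup>+x. nsum (F \<circ> prod.swap) x \<partial>M)"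
  using assms
proof (induction rule: borel_measurable_induct)
  case (cong f g)
  then have "f = g" by auto
  then show ?case using cong by simp
next
  case (set A)
  have "indicator A \<circ> prod.swap = (indicator (prod.swap ` A) :: _ \<Rightarrow> ennreal)"
    by (force simp: indicator_def)
  then show ?case using nn_integral_nsum_swap_set[OF set] by simp
next
  case (mult u c)
  have eq: "nsum (\<lambda>x. c * v x) x = c * nsum v x" for v :: "'a \<times> 'a \<Rightarrow> ennreal" and x
    by (simp add: nsum_def sum_distrib_left)
  have "nsum u \<in> borel_measurable M" "nsum (u \<circ> prod.swap) \<in> borel_measurable M"
    using mult by (auto intro!: nsum_measurable measurable_comp[OF swap_measurable])
  then show ?case using mult by (simp add: eq nn_integral_cmult comp_def)
next
  case (add u v)
  have eq: "nsum (\<lambda>x. f x + g x) x = nsum f x + nsum g x" for f g :: "'a \<times> 'a \<Rightarrow> ennreal" and x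
    by (simp add: nsum_def sum.distrib)
  have "nsum w \<in> borel_measurable M" "nsum (w \<circ> prod.swap) \<in> borel_measurable M" if "w \<in> {u, v}" for w
    using add that by (auto intro!: nsum_measurable measurable_comp[OF swap_measurable])
  then show ?case using add by (simp add: eq nn_integral_add comp_def)
next
  case (seq U)
  have eq: "nsum (\<lambda>p. SUP i. V i p) x = (SUP i. nsum (V i) x)" if "incseq V"
    for V :: "nat \<Rightarrow> 'a \<times> 'a \<Rightarrow> ennreal" and x
  proof (cases "x \<in> X")
    case True
    have "(SUP i. \<Sum>y\<in>neighbours E x. V i (x, y)) = (\<Sum>y\<in>neighbours E x. SUP i. V i (x, y))"
      by (rule ennreal_SUP_sum) (use that in \<open>auto simp: incseq_def le_fun_def\<close>)
    then show ?thesis using True by (simp add: nsum_def)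
  qed (simp add: nsum_def)
  have inc: "incseq (\<lambda>i. nsum (V i))" if "incseq V" for V :: "nat \<Rightarrow> 'a \<times> 'a \<Rightarrow> ennreal"
    using that by (auto simp: incseq_def le_fun_def nsum_def intro!: sum_mono)
  have int: "(\<integral>\<^sup>+x. nsum (\<lambda>p. SUP i. V i p) x \<partial>M) = (SUP i. \<integral>\<^sup>+x. nsum (V i) x \<partial>M)"
    if "incseq V" "\<And>i. V i \<in> borel_measurable borel" for V :: "nat \<Rightarrow> 'a \<times> 'a \<Rightarrow> ennreal"
    unfolding eq[OF that(1)] by (intro nn_integral_monotone_convergence_SUP inc nsum_measurable that)
  have 1: "(SUP i. U i) = (\<lambda>p. SUP i. U i p)" by (rule ext) (simp add: image_comp)
  have 2: "(SUP i. U i) \<circ> prod.swap = (\<lambda>p. SUP i. (U i \<circ> prod.swap) p)" by (rule ext) (simp add: image_comp)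
  have "incseq (\<lambda>i. U i \<circ> prod.swap)" using \<open>incseq U\<close> by (auto simp: incseq_def le_fun_def)
  then have "(\<integral>\<^sup>+x. nsum ((SUP i. U i) \<circ> prod.swap) x \<partial>M) = (SUP i. \<integral>\<^sup>+x. nsum (U i \<circ> prod.swap) x \<partial>M)"
    unfolding 2 by (intro int measurable_comp[OF swap_measurable] seq)
  moreover have "(\<integral>\<^sup>+x. nsum (SUP i. U i) x \<partial>M) = (SUP i. \<integral>\<^sup>+x. nsum (U i) x \<partial>M)"
    unfolding 1 by (intro int seq)
  moreover have "(\<integral>\<^sup>+x. nsum (U i) x \<partial>M) = (\<integral>\<^sup>+x. nsum (U i \<circ> prod.swap) x \<partial>M)" for i
    by (rule seq)
  ultimately show ?case by (simp only:)
qed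

end

section \<open>The adjacency operator on real square-integrable functions\<close>

instantiation "fun" :: (type, real_vector) real_vector
begin
definition scaleR_fun :: "real \<Rightarrow> ('a \<Rightarrow> 'b) \<Rightarrow> 'a \<Rightarrow> 'b" where
  "scaleR_fun c f = (\<lambda>x. c *\<^sub>R f x)"
instance by standard (auto simp: scaleR_fun_def fun_eq_iff scaleR_add_right scaleR_add_left)
end

lemma scaleR_fun_apply [simp]: "(c *\<^sub>R f) x = c *\<^sub>R f x" by (simp add: scaleR_fun_def)

lemma sum_fun_apply: "sum f A x = (\<Sum>i\<in>A. f i x)"
  for f :: "'i \<Rightarrow> 'a \<Rightarrow> 'b::comm_monoid_add"
  by (induction A rule: infinite_finite_induct) auto

text \<open>Real functions suffice, since the adjacency operator acts separately on real and
  imaginary parts.\<close>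

definition real_L2 :: "'a measure \<Rightarrow> ('a \<Rightarrow> real) set" where
  "real_L2 M = {f \<in> borel_measurable M. integrable M (\<lambda>x. (f x)\<^sup>2)}"

definition L2_ip :: "'a measure \<Rightarrow> ('a \<Rightarrow> real) \<Rightarrow> ('a \<Rightarrow> real) \<Rightarrow> real" where
  "L2_ip M f g = (\<integral>x. f x * g x \<partial>M)"

lemma real_L2D: "f \<in> real_L2 M \<Longrightarrow> f \<in> borel_measurable M" "f \<in> real_L2 M \<Longrightarrow> integrable M (\<lambda>x. (f x)\<^sup>2)"
  by (auto simp: real_L2_def)

lemma real_L2_mult_integrable:
  assumes f: "f \<in> real_L2 M" and g: "g \<in> real_L2 M"
  shows "integrable M (\<lambda>x. f x * g x)"
proof (rule Bochner_Integration.integrable_bound)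
  show "integrable M (\<lambda>x. (f x)\<^sup>2 + (g x)\<^sup>2)" using f g by (simp add: real_L2_def)
  show "(\<lambda>x. f x * g x) \<in> borel_measurable M" using real_L2D(1)[OF f] real_L2D(1)[OF g] by simp
  have "\<bar>a * b\<bar> \<le> a\<^sup>2 + b\<^sup>2" for a b :: real
  proof -
    have "0 \<le> (\<bar>a\<bar> - \<bar>b\<bar>)\<^sup>2" by simp
    also have "\<dots> = a\<^sup>2 + b\<^sup>2 - 2 * \<bar>a * b\<bar>" by (simp add: power2_diff abs_mult)
    finally show ?thesis using abs_ge_zero[of "a * b"] by linarith
  qed
  then show "AE x in M. norm (f x * g x) \<le> norm ((f x)\<^sup>2 + (g x)\<^sup>2)" by simp
qed

lemma real_L2_bound:
  assumes "f \<in> borel_measurable M" "integrable M g" "AE x in M. (f x)\<^sup>2 \<le> g x"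
  shows "f \<in> real_L2 M"
  unfolding real_L2_def
proof (intro CollectI conjI)
  show "integrable M (\<lambda>x. (f x)\<^sup>2)"
  proof (rule Bochner_Integration.integrable_bound[OF assms(2)])
    show "AE x in M. norm ((f x)\<^sup>2) \<le> norm (g x)" using assms(3) by eventually_elim auto
  qed (use assms in simp)
qed (rule assms)

lemma real_L2_scale: "f \<in> real_L2 M \<Longrightarrow> (\<lambda>x. c * f x) \<in> real_L2 M"
  by (auto simp: real_L2_def power_mult_distrib)

lemma real_L2_add:
  assumes f: "f \<in> real_L2 M" and g: "g \<in> real_L2 M" shows "(\<lambda>x. f x + g x) \<in> real_L2 M"
proof (rule real_L2_bound)
  show "integrable M (\<lambda>x. 2 * (f x)\<^sup>2 + 2 * (g x)\<^sup>2)" using f g by (simp add: real_L2_def)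
  show "(\<lambda>x. f x + g x) \<in> borel_measurable M" using real_L2D(1)[OF f] real_L2D(1)[OF g] by simp
  have "(a + b)\<^sup>2 \<le> 2 * a\<^sup>2 + 2 * b\<^sup>2" for a b :: real
    using zero_le_power2[of "a - b"] by (simp add: power2_eq_square algebra_simps)
  then show "AE x in M. (f x + g x)\<^sup>2 \<le> 2 * (f x)\<^sup>2 + 2 * (g x)\<^sup>2" by simp
qed

lemma real_L2_subspace: "subspace (real_L2 M)"
  unfolding subspace_def
proof (intro conjI ballI allI)
  show "0 \<in> real_L2 M" by (simp add: real_L2_def zero_fun_def)
  show "f + g \<in> real_L2 M" if "f \<in> real_L2 M" "g \<in> real_L2 M" for f g
    using real_L2_add[OF that] by (simp add: plus_fun_def)
  show "c *\<^sub>R f \<in> real_L2 M" if "f \<in> real_L2 M" for f c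
    using real_L2_scale[OF that] by (simp add: scaleR_fun_def)
qed

lemma real_L2_semi_inner: "semi_inner (real_L2 M) (L2_ip M)"
proof
  fix f g h :: "'a \<Rightarrow> real" and c :: real
  assume f: "f \<in> real_L2 M"
  show "0 \<le> L2_ip M f f" unfolding L2_ip_def by (intro integral_nonneg_AE) auto
  assume g: "g \<in> real_L2 M"
  show "L2_ip M f g = L2_ip M g f" by (simp add: L2_ip_def mult.commute)
  show "L2_ip M (c *\<^sub>R f) g = c * L2_ip M f g" by (simp add: L2_ip_def mult.assoc)
  assume h: "h \<in> real_L2 M"
  show "L2_ip M (f + g) h = L2_ip M f h + L2_ip M g h"
    unfolding L2_ip_def using real_L2_mult_integrable[OF f h] real_L2_mult_integrable[OF g h]
    by (simp add: distrib_right)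
qed (rule real_L2_subspace)

lemma L2_ip_self: "L2_ip M f f = (\<integral>x. (f x)\<^sup>2 \<partial>M)"
  by (simp add: L2_ip_def power2_eq_square)

text \<open>The Riesz-Fischer argument. The pointwise sum \<open>G\<close> of the
  \<open>\<bar>u n x\<bar>\<close> is square-integrable by monotone convergence, as its partial sums
  have norm at most \<open>K\<close>, and it dominates the remainders of the series.\<close>

lemma (in prob_space) real_L2_complete:
  assumes u: "\<And>n. u n \<in> real_L2 M" and sm: "summable (\<lambda>n. sqrt (L2_ip M (u n) (u n)))"
  shows "\<exists>s\<in>real_L2 M. (\<lambda>n. sqrt (L2_ip M (s - sum u {..<n}) (s - sum u {..<n}))) \<longlonglongrightarrow> 0"
proof -
  interpret semi_inner "real_L2 M" "L2_ip M" by (rule real_L2_semi_inner)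
  have um: "u n \<in> borel_measurable M" for n by (rule real_L2D[OF u])
  define v where "v n = (\<lambda>x. \<bar>u n x\<bar>)" for n
  have vH: "v n \<in> real_L2 M" for n using u[of n] by (auto simp: real_L2_def v_def)
  have vm: "v n \<in> borel_measurable M" for n by (rule real_L2D[OF vH])
  have nv: "nm (v n) = nm (u n)" for n by (simp add: nm_def L2_ip_self v_def)
  define K where "K = (\<Sum>n. nm (u n))"
  have smn: "summable (\<lambda>n. nm (u n))" using sm by (simp add: nm_def)
  \<comment> \<open>On a probability space, pairing with 1 bounds the integral of \<open>v n\<close>
    by \<open>nm (u n)\<close>; this gives absolute convergence almost everywhere.\<close>
  have oneH: "(\<lambda>_. 1) \<in> real_L2 M" by (simp add: real_L2_def)
  have nm1: "nm (\<lambda>_. 1) = 1" by (simp add: nm_def L2_ip_self prob_space)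
  have vi: "integrable M (v n)" for n using real_L2_mult_integrable[OF vH oneH] by simp
  have vle: "(\<integral>x. v n x \<partial>M) \<le> nm (u n)" for n
    using ip_cs[OF vH oneH, of n] by (simp add: nm1 nv L2_ip_def)
  have "AE x in M. summable (\<lambda>n. v n x)"
  proof -
    have "(\<integral>\<^sup>+x. (\<Sum>n. ennreal (v n x)) \<partial>M) = (\<Sum>n. \<integral>\<^sup>+x. ennreal (v n x) \<partial>M)"
      by (intro nn_integral_suminf) (use vm in simp)
    also have "\<dots> = (\<Sum>n. ennreal (\<integral>x. v n x \<partial>M))"
      by (intro suminf_cong nn_integral_eq_integral vi) (auto simp: v_def)
    also have "\<dots> \<le> (\<Sum>n. ennreal (nm (u n)))"
      by (intro suminf_le ennreal_leI vle) auto
    also have "\<dots> = ennreal K" unfolding K_def using smn u by (intro suminf_ennreal2) auto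
    finally have "(\<integral>\<^sup>+x. (\<Sum>n. ennreal (v n x)) \<partial>M) \<noteq> \<infinity>" by (auto simp: top_unique)
    then have "AE x in M. (\<Sum>n. ennreal (v n x)) \<noteq> \<infinity>"
      by (intro nn_integral_PInf_AE) (use vm in simp)
    then show ?thesis by eventually_elim (intro summable_suminf_not_top, auto simp: v_def)
  qed note AEs = this
  define G where "G x = (\<Sum>n. v n x)" for x
  define s where "s x = (\<Sum>n. u n x)" for x
  have Gm: "G \<in> borel_measurable M" and sm: "s \<in> borel_measurable M"
    unfolding G_def s_def by (intro borel_measurable_suminf vm um)+
  have SH: "sum v {..<n} \<in> real_L2 M" "sum u {..<n} \<in> real_L2 M" for n
    by (induction n) (auto simp: vH u)
  have nS: "nm (sum v {..<n}) \<le> K" for n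
  proof -
    have "nm (sum v {..<n}) \<le> (\<Sum>i<n. nm (u i))"
    proof (induction n)
      case 0 show ?case by (simp add: nm_def L2_ip_self)
    next
      case (Suc n)
      have eq: "sum v {..<Suc n} = sum v {..<n} + v n" by (simp only: sum.lessThan_Suc)
      have "nm (sum v {..<Suc n}) \<le> nm (sum v {..<n}) + nm (v n)"
        unfolding eq by (rule nm_triangle[OF SH(1) vH])
      then show ?case using Suc unfolding nv sum.lessThan_Suc[of "\<lambda>i. nm (u i)"] by linarith
    qed
    also have "\<dots> \<le> K" unfolding K_def using smn u by (intro sum_le_suminf) auto
    finally show ?thesis .
  qed
  have Sle: "(\<Sum>i<m. v i x) \<le> (\<Sum>i<n. v i x)" if "m \<le> n" for m n x
    by (rule sum_mono2) (use that in \<open>auto simp: v_def\<close>)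
  have S0: "0 \<le> (\<Sum>i<n. v i x)" for n x by (auto simp: v_def intro: sum_nonneg)
  have bnd: "(\<integral>x. (\<Sum>i<n. v i x)\<^sup>2 \<partial>M) \<le> K\<^sup>2" for n
  proof -
    have "(\<integral>x. (\<Sum>i<n. v i x)\<^sup>2 \<partial>M) = (nm (sum v {..<n}))\<^sup>2"
      using nm_sq[OF SH(1)] by (simp add: L2_ip_self sum_fun_apply)
    also have "\<dots> \<le> K\<^sup>2" by (intro power_mono nS nm_nonneg SH)
    finally show ?thesis .
  qed
  have int: "integrable M (\<lambda>x. (\<Sum>i<n. v i x)\<^sup>2)" for n
    using real_L2D(2)[OF SH(1)] by (simp add: sum_fun_apply)
  have "incseq (\<lambda>n. \<integral>x. (\<Sum>i<n. v i x)\<^sup>2 \<partial>M)"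
    unfolding incseq_def by (intro allI impI integral_mono int power_mono Sle S0)
  then have "\<exists>L. (\<lambda>n. \<integral>x. (\<Sum>i<n. v i x)\<^sup>2 \<partial>M) \<longlonglongrightarrow> L"
    by (rule incseq_convergent[of _ "K\<^sup>2"]) (use bnd in auto)
  then obtain L where L: "(\<lambda>n. \<integral>x. (\<Sum>i<n. v i x)\<^sup>2 \<partial>M) \<longlonglongrightarrow> L" ..
  have G2: "integrable M (\<lambda>x. (G x)\<^sup>2)"
  proof (rule integrable_monotone_convergence[OF int _ _ L])
    show "AE x in M. mono (\<lambda>n. (\<Sum>i<n. v i x)\<^sup>2)"
      by (auto simp: mono_def intro!: power_mono Sle S0)
    show "AE x in M. (\<lambda>n. (\<Sum>i<n. v i x)\<^sup>2) \<longlonglongrightarrow> (G x)\<^sup>2"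
      using AEs by eventually_elim (auto simp: G_def intro!: tendsto_power summable_LIMSEQ)
  qed (use Gm in simp)
  have AEu: "AE x in M. summable (\<lambda>n. u n x)"
    using AEs by eventually_elim (auto simp: v_def intro: summable_rabs_cancel)
  have tail: "AE x in M. \<forall>n. (s x - (\<Sum>i<n. u i x))\<^sup>2 \<le> (G x)\<^sup>2"
    using AEs AEu
  proof eventually_elim
    case (elim x)
    have "\<bar>s x - (\<Sum>i<n. u i x)\<bar> \<le> G x" for n
    proof -
      have eq: "s x - (\<Sum>i<n. u i x) = (\<Sum>i. u (i + n) x)"
        unfolding s_def using suminf_minus_initial_segment[OF elim(2)] by simp
      have "summable (\<lambda>i. v (i + n) x)" using summable_ignore_initial_segment[OF elim(1)] .
      then have "\<bar>\<Sum>i. u (i + n) x\<bar> \<le> (\<Sum>i. v (i + n) x)"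
        using summable_rabs[of "\<lambda>i. u (i + n) x"] by (simp add: v_def)
      also have "\<dots> \<le> G x"
        unfolding G_def using suminf_minus_initial_segment[OF elim(1), of n] S0[of x n] by simp
      finally show ?thesis using eq by simp
    qed
    moreover have "0 \<le> G x" unfolding G_def by (intro suminf_nonneg elim) (simp add: v_def)
    ultimately show ?case by (intro allI abs_le_square_iff[THEN iffD1]) simp
  qed
  have sH: "s \<in> real_L2 M"
    by (rule real_L2_bound[OF sm G2]) (use tail in eventually_elim, metis diff_zero lessThan_0 sum.empty)
  have "(\<lambda>n. \<integral>x. (s x - (\<Sum>i<n. u i x))\<^sup>2 \<partial>M) \<longlonglongrightarrow> (\<integral>x. 0 \<partial>M)"
  proof (rule integral_dominated_convergence[where w = "\<lambda>x. (G x)\<^sup>2"])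
    show "AE x in M. (\<lambda>n. (s x - (\<Sum>i<n. u i x))\<^sup>2) \<longlonglongrightarrow> 0"
      using AEu
    proof eventually_elim
      case (elim x)
      have "(\<lambda>n. (s x - (\<Sum>i<n. u i x))\<^sup>2) \<longlonglongrightarrow> (s x - s x)\<^sup>2"
        unfolding s_def by (intro tendsto_intros summable_LIMSEQ elim)
      then show ?case by simp
    qed
    show "AE x in M. norm ((s x - (\<Sum>i<n. u i x))\<^sup>2) \<le> (G x)\<^sup>2" for n
      using tail by eventually_elim auto
  qed (use sm um G2 in auto)
  then have "(\<lambda>n. sqrt (\<integral>x. (s x - (\<Sum>i<n. u i x))\<^sup>2 \<partial>M)) \<longlonglongrightarrow> sqrt 0"
    by (intro tendsto_real_sqrt) simp
  then show ?thesis using sH by (intro bexI[of _ s]) (simp_all add: L2_ip_self sum_fun_apply)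
qed

sublocale conull_regular_graph \<subseteq> semi_hilbert "real_L2 M" "L2_ip M"
  by (intro semi_hilbert.intro semi_hilbert_axioms.intro real_L2_semi_inner real_L2_complete)

section \<open>Boundedness, symmetry and energy identities\<close>

context conull_regular_graph
begin

lemma nm_eq_0_iff: "f \<in> real_L2 M \<Longrightarrow> nm f = 0 \<longleftrightarrow> (AE x in M. f x = 0)"
  by (simp add: nm_def L2_ip_self integral_nonneg_eq_0_iff_AE real_L2D)

lemma proj_measurable:
  "f \<in> borel_measurable M \<Longrightarrow> (\<lambda>p::'a\<times>'a. f (fst p)) \<in> borel_measurable borel"
  "f \<in> borel_measurable M \<Longrightarrow> (\<lambda>p::'a\<times>'a. f (snd p)) \<in> borel_measurable borel"
  unfolding measurable_M
  by (rule measurable_compose[of fst borel borel f borel] measurable_compose[of snd borel borel f borel],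
      intro borel_measurable_continuous_onI continuous_intros, assumption)+

lemma nn_integral_nsum_real:
  fixes F :: "'a \<times> 'a \<Rightarrow> real"
  assumes F: "F \<in> borel_measurable borel" "\<And>p. 0 \<le> F p"
  shows "(\<integral>\<^sup>+x. ennreal (nsum F x) \<partial>M) = (\<integral>\<^sup>+x. ennreal (nsum (F \<circ> prod.swap) x) \<partial>M)"
proof -
  have eq: "ennreal (nsum H x) = nsum (\<lambda>p. ennreal (H p)) x" if "\<And>p. 0 \<le> H p" for H x
    using that by (simp add: nsum_def sum_ennreal)
  have "(\<lambda>p. ennreal (F p)) \<in> borel_measurable borel" using F by simp
  from mass_transport[OF this] show ?thesis
    using F(2) by (simp add: eq comp_def)
qed

lemma nsum_nonneg: "(\<And>p. 0 \<le> F p) \<Longrightarrow> 0 \<le> nsum F x" for F :: "'a \<times> 'a \<Rightarrow> real"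
  by (simp add: nsum_def sum_nonneg)

lemma integral_nsum_swap:
  fixes F :: "'a \<times> 'a \<Rightarrow> real"
  assumes F: "F \<in> borel_measurable borel" "\<And>p. 0 \<le> F p" and int: "integrable M (nsum F)"
  shows "integrable M (nsum (F \<circ> prod.swap))"
    "(\<integral>x. nsum (F \<circ> prod.swap) x \<partial>M) = (\<integral>x. nsum F x \<partial>M)"
proof -
  have m: "nsum (F \<circ> prod.swap) \<in> borel_measurable M" "nsum F \<in> borel_measurable M"
    using F by (auto intro!: nsum_measurable measurable_comp[OF swap_measurable])
  have nn: "0 \<le> nsum (F \<circ> prod.swap) x" "0 \<le> nsum F x" for x using F by (auto intro: nsum_nonneg)
  show "integrable M (nsum (F \<circ> prod.swap))"
    using int m nn nn_integral_nsum_real[OF F] by (simp add: integrable_iff_bounded)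
  show "(\<integral>x. nsum (F \<circ> prod.swap) x \<partial>M) = (\<integral>x. nsum F x \<partial>M)"
    using m nn nn_integral_nsum_real[OF F] by (simp add: integral_eq_nn_integral)
qed

definition T :: "('a \<Rightarrow> real) \<Rightarrow> 'a \<Rightarrow> real" where
  "T f = nsum (\<lambda>p. f (snd p))"

lemma T_X: "x \<in> X \<Longrightarrow> T f x = (\<Sum>y\<in>neighbours E x. f y)" by (simp add: T_def nsum_def)

lemma T_measurable: "f \<in> borel_measurable M \<Longrightarrow> T f \<in> borel_measurable M"
  unfolding T_def by (intro nsum_measurable proj_measurable)

lemma T_add: "T (f + g) = T f + T g"
  by (auto simp: T_def nsum_def fun_eq_iff sum.distrib)

lemma T_scale: "T (c *\<^sub>R f) = c *\<^sub>R T f"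
  by (auto simp: T_def nsum_def fun_eq_iff sum_distrib_left)

text \<open>Regularity evaluates the sum over the first end point as
  \<open>d * (f x)\<^sup>2\<close>; mass transport carries the result to the second end
  point.\<close>

lemma integral_nsum_sq:
  assumes f: "f \<in> real_L2 M"
  shows "integrable M (nsum (\<lambda>p. (f (fst p))\<^sup>2))" "(\<integral>x. nsum (\<lambda>p. (f (fst p))\<^sup>2) x \<partial>M) = d * L2_ip M f f"
    "integrable M (nsum (\<lambda>p. (f (snd p))\<^sup>2))" "(\<integral>x. nsum (\<lambda>p. (f (snd p))\<^sup>2) x \<partial>M) = d * L2_ip M f f"
proof -
  let ?F = "\<lambda>p::'a\<times>'a. (f (fst p))\<^sup>2"
  have m: "?F \<in> borel_measurable borel" using proj_measurable(1)[of f] f by (auto simp: real_L2_def)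
  have AE: "AE x in M. nsum ?F x = real d * (f x)\<^sup>2"
    using conull by eventually_elim (simp add: nsum_def reg)
  have i: "integrable M (\<lambda>x. real d * (f x)\<^sup>2)" using f by (simp add: real_L2_def)
  show 1: "integrable M (nsum ?F)"
    by (rule integrable_cong_AE_imp[OF i nsum_measurable[OF m]]) (use AE in eventually_elim, simp)
  show 2: "(\<integral>x. nsum ?F x \<partial>M) = d * L2_ip M f f"
    using integral_cong_AE[OF nsum_measurable[OF m] borel_measurable_integrable[OF i] AE]
    by (simp add: L2_ip_self)
  have sw: "?F \<circ> prod.swap = (\<lambda>p. (f (snd p))\<^sup>2)" by auto
  show "integrable M (nsum (\<lambda>p. (f (snd p))\<^sup>2))" "(\<integral>x. nsum (\<lambda>p. (f (snd p))\<^sup>2) x \<partial>M) = d * L2_ip M f f"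
    using integral_nsum_swap[OF m _ 1] 2 unfolding sw by simp_all
qed

lemma T_real_L2:
  assumes f: "f \<in> real_L2 M" shows "T f \<in> real_L2 M"
proof (rule real_L2_bound)
  show "T f \<in> borel_measurable M" using f by (intro T_measurable real_L2D)
  show "integrable M (\<lambda>x. real d * nsum (\<lambda>p. (f (snd p))\<^sup>2) x)"
    using integral_nsum_sq(3)[OF f] by simp
  show "AE x in M. (T f x)\<^sup>2 \<le> real d * nsum (\<lambda>p. (f (snd p))\<^sup>2) x"
    using conull
  proof eventually_elim
    case (elim x)
    have "(\<Sum>y\<in>neighbours E x. f y)\<^sup>2 \<le> (\<Sum>y\<in>neighbours E x. (f y)\<^sup>2) * card (neighbours E x)"
      by (rule sum_squared_le_sum_of_squares)
    then show ?case using elim by (simp add: T_X nsum_def reg mult.commute)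
  qed
qed

lemma integral_nsum_square_add:
  assumes f: "f \<in> real_L2 M" and g: "g \<in> real_L2 M"
  shows "integrable M (nsum (\<lambda>p. (f (fst p) + g (snd p))\<^sup>2))"
    "(\<integral>x. nsum (\<lambda>p. (f (fst p) + g (snd p))\<^sup>2) x \<partial>M) = d * L2_ip M f f + 2 * L2_ip M f (T g) + d * L2_ip M g g"
proof -
  have eq: "nsum (\<lambda>p. (f (fst p) + g (snd p))\<^sup>2) x =
      nsum (\<lambda>p. (f (fst p))\<^sup>2) x + 2 * (f x * T g x) + nsum (\<lambda>p. (g (snd p))\<^sup>2) x" for x
    by (simp add: T_def nsum_def power2_sum sum.distrib sum_distrib_left algebra_simps)
  note i = integral_nsum_sq[OF f] integral_nsum_sq[OF g] real_L2_mult_integrable[OF f T_real_L2[OF g]]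
  show "integrable M (nsum (\<lambda>p. (f (fst p) + g (snd p))\<^sup>2))"
    unfolding eq[abs_def] using i by (intro Bochner_Integration.integrable_add integrable_mult_right)
  show "(\<integral>x. nsum (\<lambda>p. (f (fst p) + g (snd p))\<^sup>2) x \<partial>M) = d * L2_ip M f f + 2 * L2_ip M f (T g) + d * L2_ip M g g"
    unfolding eq using i by (simp add: L2_ip_def)
qed

text \<open>Mass transport is stated for nonnegative functions, hence the square
  \<open>(f x + g y)\<^sup>2\<close> in place of the product \<open>f x * g y\<close>: the pure
  terms agree on both sides and the cross terms remain.\<close>

lemma T_sym:
  assumes f: "f \<in> real_L2 M" and g: "g \<in> real_L2 M"
  shows "L2_ip M (T f) g = L2_ip M f (T g)"
proof -
  let ?F = "\<lambda>p::'a\<times>'a. (f (fst p) + g (snd p))\<^sup>2"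
  have m: "?F \<in> borel_measurable borel"
    using proj_measurable(1)[of f] proj_measurable(2)[of g] f g by (auto simp: real_L2_def)
  have sw: "?F \<circ> prod.swap = (\<lambda>p. (g (fst p) + f (snd p))\<^sup>2)" by (auto simp: add.commute)
  have "(\<integral>x. nsum (\<lambda>p. (g (fst p) + f (snd p))\<^sup>2) x \<partial>M) = (\<integral>x. nsum ?F x \<partial>M)"
    using integral_nsum_swap(2)[OF m _ integral_nsum_square_add(1)[OF f g]] unfolding sw by simp
  then have "L2_ip M g (T f) = L2_ip M f (T g)"
    using integral_nsum_square_add(2)[OF f g] integral_nsum_square_add(2)[OF g f] by simp
  then show ?thesis using ip_sym[OF T_real_L2[OF f] g] by simp
qed

lemma energy_add:
  assumes f: "f \<in> real_L2 M"
  shows "(\<integral>x. nsum (\<lambda>p. (f (fst p) + f (snd p))\<^sup>2) x \<partial>M) = 2 * L2_ip M (real d *\<^sub>R f + T f) f"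
  using integral_nsum_square_add(2)[OF f f] T_sym[OF f f] f T_real_L2[OF f]
  by (simp add: ip_simps)

lemma energy_diff:
  assumes f: "f \<in> real_L2 M"
  shows "integrable M (nsum (\<lambda>p. (f (fst p) - f (snd p))\<^sup>2))"
    "(\<integral>x. nsum (\<lambda>p. (f (fst p) - f (snd p))\<^sup>2) x \<partial>M) = 2 * L2_ip M (real d *\<^sub>R f - T f) f"
proof -
  have mf: "- f \<in> real_L2 M" using f by (rule H_closed)
  have Tm: "T (- f) = - T f" using T_scale[of "-1" f] by simp
  show "integrable M (nsum (\<lambda>p. (f (fst p) - f (snd p))\<^sup>2))"
    using integral_nsum_square_add(1)[OF f mf] by simp
  show "(\<integral>x. nsum (\<lambda>p. (f (fst p) - f (snd p))\<^sup>2) x \<partial>M) = 2 * L2_ip M (real d *\<^sub>R f - T f) f"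
    using integral_nsum_square_add(2)[OF f mf] T_sym[OF f f] f T_real_L2[OF f] ip_minus[OF f mf] ip_sym[of f "- f"]
      ip_minus[OF f f] ip_minus[OF T_real_L2[OF f] f] ip_sym[of f "- T f"] mf H_closed(5)[OF T_real_L2[OF f]]
    by (simp add: ip_simps Tm)
qed

text \<open>Each form is half an integral of squares over edges. The two operators add up to
  \<open>2 * d\<close> times the identity, so positivity of one is the upper bound for the
  other.\<close>

lemma posop_add: "posop (2 * real d) (\<lambda>f. real d *\<^sub>R f + T f)"
  and posop_diff: "posop (2 * real d) (\<lambda>f. real d *\<^sub>R f - T f)"
proof -
  have nn: "0 \<le> L2_ip M (real d *\<^sub>R f + T f) f" "0 \<le> L2_ip M (real d *\<^sub>R f - T f) f" if f: "f \<in> real_L2 M" for f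
  proof -
    have "0 \<le> (\<integral>x. nsum (\<lambda>p. (f (fst p) + f (snd p))\<^sup>2) x \<partial>M)"
      "0 \<le> (\<integral>x. nsum (\<lambda>p. (f (fst p) - f (snd p))\<^sup>2) x \<partial>M)"
      by (auto intro!: integral_nonneg_AE nsum_nonneg)
    then show "0 \<le> L2_ip M (real d *\<^sub>R f + T f) f" "0 \<le> L2_ip M (real d *\<^sub>R f - T f) f"
      by (simp_all add: energy_add energy_diff f)
  qed
  show "posop (2 * real d) (\<lambda>f. real d *\<^sub>R f + T f)" "posop (2 * real d) (\<lambda>f. real d *\<^sub>R f - T f)"
    unfolding posop_def symop_def using nn
    by (auto simp: T_real_L2 T_add T_scale ip_simps T_sym algebra_simps)
qed

end

section \<open>Spectral gap and bipartiteness\<close>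

lemma AE_nonneg_integral_eq_0:
  fixes f :: "'a \<Rightarrow> real"
  assumes "integrable M f" "AE x in M. 0 \<le> f x" "(\<integral>x. f x \<partial>M) = 0"
  shows "AE x in M. f x = 0"
  using integral_nonneg_eq_0_iff_AE[OF assms(1,2)] assms(3) by simp

context conull_regular_graph
begin

lemma adjacency_op_Re_Im:
  assumes "x \<in> X"
  shows "adjacency_op E f x = Complex (T (\<lambda>x. Re (f x)) x) (T (\<lambda>x. Im (f x)) x)"
  using assms by (simp add: adjacency_op_def T_X complex_eq_iff)

lemma L2_Re_Im:
  assumes "f \<in> L2 M"
  shows "(\<lambda>x. Re (f x)) \<in> real_L2 M" "(\<lambda>x. Im (f x)) \<in> real_L2 M"
proof -
  have f: "f \<in> borel_measurable M" "integrable M (\<lambda>x. (cmod (f x))\<^sup>2)" using assms by (auto simp: L2_def)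
  show "(\<lambda>x. Re (f x)) \<in> real_L2 M" "(\<lambda>x. Im (f x)) \<in> real_L2 M"
    by (rule real_L2_bound[OF _ f(2)]; use f(1) in \<open>simp add: cmod_power2\<close>)+
qed

text \<open>The real part of a complex solution solves the real equation. The spectrum is defined
  through \<open>T - t\<close>, whence the sign of \<open>- g x\<close>.\<close>

lemma surjop_resolvent:
  assumes "complex_of_real t \<notin> adjacency_spectrum M E"
  shows "surjop (\<lambda>f. t *\<^sub>R f - T f)"
  unfolding surjop_def
proof
  fix g assume g: "g \<in> real_L2 M"
  have gL: "(\<lambda>x. complex_of_real (- g x)) \<in> L2 M"
    using g by (auto simp: L2_def real_L2_def)
  have "\<forall>g\<in>L2 M. \<exists>f\<in>L2 M. AE x in M. adjacency_op E f x - complex_of_real t * f x = g x"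
    using assms unfolding adjacency_spectrum_def mem_Collect_eq not_not by (rule conjunct1)
  from bspec[OF this gL] obtain f where f: "f \<in> L2 M"
    "AE x in M. adjacency_op E f x - complex_of_real t * f x = complex_of_real (- g x)" ..
  let ?f = "\<lambda>x. Re (f x)"
  have fH: "?f \<in> real_L2 M" using L2_Re_Im f by blast
  have "AE x in M. (t *\<^sub>R ?f - T ?f - g) x = 0"
    using f(2) conull by eventually_elim (simp add: adjacency_op_Re_Im complex_eq_iff)
  then have "nm (t *\<^sub>R ?f - T ?f - g) = 0"
    using fH g T_real_L2 by (subst nm_eq_0_iff) auto
  then show "\<exists>f\<in>real_L2 M. nm (t *\<^sub>R f - T f - g) = 0" using fH by blast
qed

text \<open>Meant for its contrapositive, which supplies vectors of small energy. Coercivity gives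
  injectivity directly and surjectivity by the Neumann series; real and imaginary parts are solved
  separately.\<close>

lemma coercive_imp_not_in_spectrum:
  assumes \<delta>: "\<delta> > 0" "\<And>f. f \<in> real_L2 M \<Longrightarrow> \<delta> * L2_ip M f f \<le> L2_ip M (real d *\<^sub>R f + T f) f"
  shows "complex_of_real (- real d) \<notin> adjacency_spectrum M E"
proof -
  define P where "P f = real d *\<^sub>R f + T f" for f
  have PH: "P f \<in> real_L2 M" if "f \<in> real_L2 M" for f using that T_real_L2 by (auto simp: P_def)
  have P_apply: "P f x = real d * f x + T f x" for f x by (simp add: P_def)
  have surj: "surjop P"
    using posop_bounded_below_imp_surj[OF posop_add \<delta>] unfolding P_def by blast
  have inj: "AE x in M. f x = 0" if f: "f \<in> real_L2 M" "AE x in M. P f x = 0" for f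
  proof -
    have "nm (P f) = 0" using f PH by (simp add: nm_eq_0_iff)
    then have "L2_ip M (P f) f = 0" using ip_cs[OF PH f(1), of f] f by simp
    then have "\<delta> * L2_ip M f f \<le> 0" using \<delta>(2)[OF f(1)] by (simp add: P_def)
    then have "L2_ip M f f = 0" using \<delta>(1) ip_nonneg[OF f(1)] by (simp add: mult_le_0_iff)
    then show ?thesis using nm_eq_0_iff[OF f(1)] by (simp add: nm_def)
  qed
  have sol: "\<exists>f\<in>real_L2 M. AE x in M. P f x = g x" if g: "g \<in> real_L2 M" for g
  proof -
    obtain f where f: "f \<in> real_L2 M" "nm (P f - g) = 0" using surj g by (auto simp: surjop_def)
    have "AE x in M. (P f - g) x = 0" using f g PH nm_eq_0_iff[of "P f - g"] by auto
    then have "AE x in M. P f x = g x" by eventually_elim simp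
    then show ?thesis using f by blast
  qed
  have 1: "\<exists>f\<in>L2 M. AE x in M. adjacency_op E f x - complex_of_real (- real d) * f x = g x"
    if g: "g \<in> L2 M" for g
  proof -
    obtain a where a: "a \<in> real_L2 M" "AE x in M. P a x = Re (g x)" using sol L2_Re_Im(1)[OF g] by blast
    obtain b where b: "b \<in> real_L2 M" "AE x in M. P b x = Im (g x)" using sol L2_Re_Im(2)[OF g] by blast
    let ?f = "\<lambda>x. complex_of_real (a x) + \<i> * complex_of_real (b x)"
    have "?f \<in> L2 M"
      unfolding L2_def
    proof (intro CollectI conjI)
      show "?f \<in> borel_measurable M" using real_L2D(1)[OF a(1)] real_L2D(1)[OF b(1)] by simp
      have "(\<lambda>x. (cmod (?f x))\<^sup>2) = (\<lambda>x. (a x)\<^sup>2 + (b x)\<^sup>2)" by (simp add: cmod_power2)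
      then show "integrable M (\<lambda>x. (cmod (?f x))\<^sup>2)" using real_L2D(2)[OF a(1)] real_L2D(2)[OF b(1)] by simp
    qed
    moreover have "AE x in M. adjacency_op E ?f x - complex_of_real (- real d) * ?f x = g x"
      using a(2) b(2) conull
      by eventually_elim (simp add: adjacency_op_Re_Im complex_eq_iff P_apply)
    ultimately show ?thesis by blast
  qed
  have 2: "AE x in M. f x = 0"
    if f: "f \<in> L2 M" "AE x in M. adjacency_op E f x - complex_of_real (- real d) * f x = 0" for f
  proof -
    have "AE x in M. P (\<lambda>x. Re (f x)) x = 0" "AE x in M. P (\<lambda>x. Im (f x)) x = 0"
      using f(2) conull by (eventually_elim, simp add: adjacency_op_Re_Im complex_eq_iff P_apply)+
    from inj[OF L2_Re_Im(1)[OF f(1)] this(1)] inj[OF L2_Re_Im(2)[OF f(1)] this(2)]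
    show ?thesis by eventually_elim (simp add: complex_eq_iff)
  qed
  show ?thesis unfolding adjacency_spectrum_def mem_Collect_eq not_not
    by (intro conjI ballI impI) (erule 1, rule 2)
qed

text \<open>Vanishing energy makes \<open>f\<close> constant along edges outside a null set, and
  along whole components once that set is enlarged to \<open>Z\<close>. By ergodicity the sets where
  \<open>f\<close> is below or above its mean are null or conull, and conull would contradict the
  mean.\<close>

lemma ergodic_invariant_const:
  assumes erg: "ergodic_graph M E" and spec: "complex_of_real (real d + 1) \<notin> adjacency_spectrum M E"
    and f: "f \<in> real_L2 M" and inv: "L2_ip M (real d *\<^sub>R f - T f) f = 0"
  shows "AE x in M. f x = (\<integral>x. f x \<partial>M)"
proof -
  let ?D = "nsum (\<lambda>p. (f (fst p) - f (snd p))\<^sup>2)"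
  have fm: "f \<in> borel_measurable M" using f by (rule real_L2D)
  have "(\<lambda>p. (f (fst p) - f (snd p))\<^sup>2) \<in> borel_measurable borel"
    using proj_measurable[OF fm] by simp
  then have Dm: "?D \<in> borel_measurable M" by (rule nsum_measurable)
  have "AE x in M. ?D x = 0"
    by (rule AE_nonneg_integral_eq_0) (use energy_diff[OF f] inv in \<open>auto intro!: AE_I2 nsum_nonneg\<close>)
  define Z0 where "Z0 = - {x\<in>X. ?D x = 0}"
  have "AE x in M. x \<notin> Z0" using \<open>AE x in M. ?D x = 0\<close> conull by eventually_elim (simp add: Z0_def)
  moreover have "Z0 \<in> sets M"
  proof -
    have "{x\<in>X. ?D x = 0} = X \<inter> (?D -` {0} \<inter> space M)" by (auto simp: space_M)
    also have "\<dots> \<in> sets M" using X measurable_sets[OF Dm, of "{0}"] by auto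
    finally show ?thesis unfolding Z0_def sets_M by (rule borel_comp)
  qed
  ultimately have Z0: "Z0 \<in> null_sets M" by (simp add: AE_iff_null_sets)
  obtain Z where Z: "Z \<in> null_sets M" "Z0 \<subseteq> Z" "\<And>x y. x \<notin> Z \<Longrightarrow> E x y \<Longrightarrow> y \<notin> Z"
    by (rule null_sets_edge_closure[OF std E_borel Z0 _ spec]) (use reg in \<open>auto simp: Z0_def\<close>)
  have step: "f y = f x" if "x \<notin> Z" "E x y" for x y
  proof -
    have x: "x \<in> X" "?D x = 0" using that Z(2) by (auto simp: Z0_def)
    then have "\<forall>y\<in>neighbours E x. (f x - f y)\<^sup>2 = 0"
      using fin_nb[OF x(1)] by (simp add: nsum_def sum_nonneg_eq_0_iff)
    then show ?thesis using that(2) by (simp add: neighbours_def)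
  qed
  have conn: "y \<notin> Z \<and> f y = f x" if "connected_rel E x y" "x \<notin> Z" for x y
    using that by (induction rule: rtranclp_induct) (auto simp: step dest: Z(3))
  let ?m = "\<integral>x. f x \<partial>M"
  have fi: "integrable M f"
    using real_L2_mult_integrable[OF f, of "\<lambda>_. 1"] by (simp add: real_L2_def)
  have zero_one: "measure M {x. x \<notin> Z \<and> P (f x)} = 0 \<or> measure M {x. x \<notin> Z \<and> P (f x)} = 1"
    and meas: "{x. x \<notin> Z \<and> P (f x)} \<in> sets M"
    if P: "{t. P t} \<in> sets borel" for P
  proof -
    have "{x. x \<notin> Z \<and> P (f x)} = (space M - Z) \<inter> (f -` {t. P t} \<inter> space M)" by (auto simp: space_M)
    also have "\<dots> \<in> sets M" using Z(1) measurable_sets[OF fm P] by auto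
    finally show s: "{x. x \<notin> Z \<and> P (f x)} \<in> sets M" .
    show "measure M {x. x \<notin> Z \<and> P (f x)} = 0 \<or> measure M {x. x \<notin> Z \<and> P (f x)} = 1"
      using erg s conn unfolding ergodic_graph_def by (metis (mono_tags, lifting) mem_Collect_eq)
  qed
  have AE0: "AE x in M. \<not> P (f x)"
    if P: "{t. P t} \<in> sets borel" and no: "\<not> (AE x in M. P (f x))" for P
  proof -
    have "measure M {x. x \<notin> Z \<and> P (f x)} \<noteq> 1"
    proof
      assume "measure M {x. x \<notin> Z \<and> P (f x)} = 1"
      then have "AE x in M. x \<in> {x. x \<notin> Z \<and> P (f x)}" using meas[OF P] by (simp add: prob_eq_1)
      then have "AE x in M. P (f x)" by eventually_elim simp
      then show False using no by simp
    qed
    then have "{x. x \<notin> Z \<and> P (f x)} \<in> null_sets M"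
      using zero_one[OF P] meas[OF P] by (auto simp: null_sets_def emeasure_eq_measure)
    from AE_not_in[OF this] AE_not_in[OF Z(1)] show ?thesis by eventually_elim simp
  qed
  \<comment> \<open>The choices \<open>c = 1\<close> and \<open>c = -1\<close> treat the two sides
    of the mean.\<close>
  have contr: False if c: "\<bar>c\<bar> = (1::real)" and AE: "AE x in M. c * f x < c * ?m" for c
  proof -
    have int: "integrable M (\<lambda>x. c * ?m - c * f x)" using fi by simp
    have "(\<integral>x. c * ?m - c * f x \<partial>M) = 0" using fi by (simp add: prob_space)
    moreover have "AE x in M. 0 \<le> c * ?m - c * f x" using AE by eventually_elim simp
    ultimately have "AE x in M. c * ?m - c * f x = 0" using AE_nonneg_integral_eq_0[OF int] by blast
    then have "AE x in M. False" using AE by eventually_elim linarith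
    then show False by simp
  qed
  have "AE x in M. \<not> f x < ?m" by (rule AE0) (use contr[of 1] in auto)
  moreover have "AE x in M. \<not> ?m < f x" by (rule AE0) (use contr[of "-1"] in auto)
  ultimately show ?thesis by eventually_elim simp
qed

text \<open>The projection \<open>\<psi>\<close> of \<open>f\<close> onto the kernel of
  \<open>d - T\<close> is constant by ergodicity and has the same mean as \<open>f\<close>, so
  \<open>(nm (f - \<psi>))\<^sup>2\<close> is the variance of \<open>f\<close>.\<close>

lemma poincare:
  assumes erg: "ergodic_graph M E" and gap: "has_spectral_gap M E d"
  obtains C where "C \<ge> 0"
    "\<And>f. f \<in> real_L2 M \<Longrightarrow>
      (\<integral>x. (f x - (\<integral>x. f x \<partial>M))\<^sup>2 \<partial>M) \<le> C * L2_ip M (real d *\<^sub>R f - T f) f"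
proof -
  obtain \<epsilon> where eps: "\<epsilon> > 0" "adjacency_spectrum M E \<subseteq>
     {complex_of_real t | t. - real d \<le> t \<and> t \<le> real d - \<epsilon>} \<union> {complex_of_real (real d)}"
    using gap by (auto simp: has_spectral_gap_def)
  have notin: "complex_of_real t \<notin> adjacency_spectrum M E" if "real d - \<epsilon> < t" "t \<noteq> real d" for t
  proof
    assume "complex_of_real t \<in> adjacency_spectrum M E"
    then consider s where "complex_of_real t = complex_of_real s" "s \<le> real d - \<epsilon>"
      | "complex_of_real t = complex_of_real (real d)" using eps(2) by blast
    then show False by cases (use that in \<open>auto simp only: of_real_eq_iff\<close>)
  qed
  define S where "S f = real d *\<^sub>R f - T f" for f
  \<comment> \<open>Positive even for \<open>d = 0\<close>, as
    \<open>form_ineq_imp_kernel_approx\<close> demands.\<close>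
  define c where "c = 2 * real d + 1"
  have c: "c > 0" by (simp add: c_def)
  have S: "posop c S"
    unfolding posop_def
  proof (intro conjI ballI)
    show "0 \<le> c" "symop S" using c posop_diff by (auto simp: posop_def S_def[abs_def])
    fix f assume f: "f \<in> real_L2 M"
    show "0 \<le> L2_ip M (S f) f" using posop_diff f by (auto simp: posop_def S_def)
    have "L2_ip M (S f) f \<le> 2 * real d * L2_ip M f f" using posop_diff f by (auto simp: posop_def S_def)
    also have "\<dots> \<le> c * L2_ip M f f" using ip_nonneg[OF f] by (intro mult_right_mono) (auto simp: c_def)
    finally show "L2_ip M (S f) f \<le> c * L2_ip M f f" .
  qed
  have SH: "S f \<in> real_L2 M" if "f \<in> real_L2 M" for f using that T_real_L2 by (auto simp: S_def)
  \<comment> \<open>The numbers \<open>d - \<mu>\<close> run through the gap between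
    \<open>d - \<epsilon>\<close> and \<open>d\<close>.\<close>
  have surj: "surjop (\<lambda>f. S f - \<mu> *\<^sub>R f)" if "0 < \<mu>" "\<mu> < \<epsilon>" for \<mu>
  proof -
    have "surjop (\<lambda>f. (real d - \<mu>) *\<^sub>R f - T f)" by (rule surjop_resolvent[OF notin]) (use that in auto)
    moreover have "(real d - \<mu>) *\<^sub>R f - T f = S f - \<mu> *\<^sub>R f" for f by (simp add: S_def algebra_simps)
    ultimately show ?thesis by simp
  qed
  have gapS: "\<epsilon> * L2_ip M (S f) f \<le> L2_ip M (S f) (S f)" if "f \<in> real_L2 M" for f
    using gap_imp_form_ineq[OF S eps(1) surj that] .
  obtain C where C: "C \<ge> 0" "\<And>f. f \<in> real_L2 M \<Longrightarrow> \<exists>\<psi>\<in>real_L2 M. nm (S \<psi>) = 0 \<and>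
      (nm (f - \<psi>))\<^sup>2 \<le> C * L2_ip M (S f) f \<and>
      (\<forall>u\<in>real_L2 M. nm (S u) = 0 \<longrightarrow> L2_ip M \<psi> u = L2_ip M f u)"
    by (rule form_ineq_imp_kernel_approx[OF S c eps(1) gapS]) (assumption, rule that, assumption, metis)
  have "(\<integral>x. (f x - (\<integral>x. f x \<partial>M))\<^sup>2 \<partial>M) \<le> C * L2_ip M (real d *\<^sub>R f - T f) f"
    if f: "f \<in> real_L2 M" for f
  proof -
    obtain \<psi> where \<psi>: "\<psi> \<in> real_L2 M" "nm (S \<psi>) = 0" "(nm (f - \<psi>))\<^sup>2 \<le> C * L2_ip M (S f) f"
      "\<And>u. u \<in> real_L2 M \<Longrightarrow> nm (S u) = 0 \<Longrightarrow> L2_ip M \<psi> u = L2_ip M f u"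
      using C(2)[OF f] by blast
    let ?one = "\<lambda>_::'a. 1::real"
    have one: "?one \<in> real_L2 M" by (simp add: real_L2_def)
    \<comment> \<open>Constants lie in the kernel by regularity, so pairing with 1 shows that
      \<open>\<psi>\<close> keeps the mean of \<open>f\<close>.\<close>
    have "AE x in M. S ?one x = 0"
      using conull by eventually_elim (simp add: S_def T_X reg)
    then have "nm (S ?one) = 0" using SH[OF one] by (simp add: nm_eq_0_iff)
    from \<psi>(4)[OF one this] have mean: "(\<integral>x. \<psi> x \<partial>M) = (\<integral>x. f x \<partial>M)" by (simp add: L2_ip_def)
    have "L2_ip M (S \<psi>) \<psi> = 0" using ip_cs[OF SH \<psi>(1), OF \<psi>(1)] \<psi>(2) by simp
    then have "AE x in M. \<psi> x = (\<integral>x. \<psi> x \<partial>M)"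
      by (intro ergodic_invariant_const[OF erg notin \<psi>(1)]) (use eps in \<open>auto simp: S_def\<close>)
    then have AE: "AE x in M. (f x - (\<integral>x. f x \<partial>M))\<^sup>2 = ((f - \<psi>) x)\<^sup>2"
      by eventually_elim (simp add: mean)
    have m: "f \<in> borel_measurable M" "\<psi> \<in> borel_measurable M" using f \<psi> by (auto dest: real_L2D)
    have "(\<integral>x. (f x - (\<integral>x. f x \<partial>M))\<^sup>2 \<partial>M) = (\<integral>x. ((f - \<psi>) x)\<^sup>2 \<partial>M)"
      by (rule integral_cong_AE[OF _ _ AE]) (use m in simp_all)
    also have "\<dots> = (nm (f - \<psi>))\<^sup>2" using f \<psi> by (simp add: nm_sq L2_ip_self del: minus_apply)
    finally show ?thesis using \<psi>(3) by (simp add: S_def)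
  qed
  then show thesis using that C(1) by blast
qed

lemma approx_bipartite:
  assumes erg: "ergodic_graph M E" and gap: "has_spectral_gap M E d"
    and spec: "complex_of_real (- real d) \<in> adjacency_spectrum M E"
  shows "approx_measurably_bipartite M E"
  unfolding approx_measurably_bipartite_def
proof (intro allI impI)
  fix eps :: real assume eps: "eps > 0"
  obtain C where C: "C \<ge> 0" "\<And>f. f \<in> real_L2 M \<Longrightarrow>
      (\<integral>x. (f x - (\<integral>x. f x \<partial>M))\<^sup>2 \<partial>M) \<le> C * L2_ip M (real d *\<^sub>R f - T f) f"
    using poincare[OF erg gap] by blast
  \<comment> \<open>The first bound keeps the variance, at most \<open>C * \<delta>\<close>, below
    or at 1/4. The second keeps the discarded measure, at most \<open>16 * C * \<delta>\<close> from
    \<open>R\<close> and \<open>2 * \<delta>\<close> from \<open>B\<close>, below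
    \<open>eps\<close>.\<close>
  define \<delta> where "\<delta> = min (1 / (4 * (C + 1))) (eps / (16 * C + 5))"
  have \<delta>: "\<delta> > 0" "C * \<delta> \<le> 1/4" "(16 * C + 4) * \<delta> < eps"
  proof -
    show "\<delta> > 0" using C(1) eps by (simp add: \<delta>_def)
    have "C * \<delta> \<le> C * (1 / (4 * (C + 1)))" using C(1) by (intro mult_left_mono) (auto simp: \<delta>_def)
    also have "\<dots> \<le> 1/4" using C(1) by (simp add: field_simps)
    finally show "C * \<delta> \<le> 1/4" .
    have "(16 * C + 4) * \<delta> < (16 * C + 5) * \<delta>" using \<open>\<delta> > 0\<close> by simp
    also have "\<dots> \<le> (16 * C + 5) * (eps / (16 * C + 5))" using C(1) by (intro mult_left_mono) (auto simp: \<delta>_def)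
    also have "\<dots> = eps" using C(1) by simp
    finally show "(16 * C + 4) * \<delta> < eps" .
  qed
  obtain g where g: "g \<in> real_L2 M" "L2_ip M (real d *\<^sub>R g + T g) g < \<delta> * L2_ip M g g"
    using coercive_imp_not_in_spectrum[OF \<delta>(1)] spec by (meson not_le)
  have gpos: "L2_ip M g g > 0"
  proof -
    have "0 \<le> L2_ip M (real d *\<^sub>R g + T g) g" using posop_add g(1) by (auto simp: posop_def)
    then have "0 < \<delta> * L2_ip M g g" using g(2) by linarith
    then show ?thesis using \<delta>(1) by (simp add: zero_less_mult_iff)
  qed
  define f where "f = (1 / sqrt (L2_ip M g g)) *\<^sub>R g"
  have f: "f \<in> real_L2 M" using g by (simp add: f_def)
  have fm: "f \<in> borel_measurable M" using f by (rule real_L2D)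
  have sq: "(1 / sqrt (L2_ip M g g)) * (1 / sqrt (L2_ip M g g)) = 1 / L2_ip M g g" using gpos by simp
  have f1: "(\<integral>x. (f x)\<^sup>2 \<partial>M) = 1"
  proof -
    have "L2_ip M f f = (1 / sqrt (L2_ip M g g)) * (1 / sqrt (L2_ip M g g)) * L2_ip M g g"
      using g by (simp add: f_def ip_simps)
    then show ?thesis using gpos unfolding sq by (simp add: L2_ip_self)
  qed
  let ?P = "nsum (\<lambda>p. (f (fst p) + f (snd p))\<^sup>2)"
  have energy: "(\<integral>x. ?P x \<partial>M) \<le> 2 * \<delta>"
  proof -
    have "real d *\<^sub>R f + T f = (1 / sqrt (L2_ip M g g)) *\<^sub>R (real d *\<^sub>R g + T g)"
      by (simp add: f_def T_scale scaleR_add_right)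
    then have "L2_ip M (real d *\<^sub>R f + T f) f =
        (1 / sqrt (L2_ip M g g)) * (1 / sqrt (L2_ip M g g)) * L2_ip M (real d *\<^sub>R g + T g) g"
      using g T_real_L2[OF g(1)] by (simp add: f_def ip_scale ip_scale_right)
    also have "\<dots> \<le> \<delta>" using g(2) gpos unfolding sq by (simp add: field_simps)
    finally show ?thesis by (simp add: energy_add f)
  qed
  have Pint: "integrable M ?P" using integral_nsum_square_add(1)[OF f f] .
  define h where "h x = \<bar>f x\<bar>" for x
  have h: "h \<in> real_L2 M" using real_L2D[OF f] by (simp add: real_L2_def h_def[abs_def])
  have hm: "h \<in> borel_measurable M" using h by (rule real_L2D)
  define m where "m = (\<integral>x. h x \<partial>M)"
  have "(\<integral>x. nsum (\<lambda>p. (h (fst p) - h (snd p))\<^sup>2) x \<partial>M) \<le> (\<integral>x. ?P x \<partial>M)"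
  proof (rule integral_mono[OF energy_diff(1)[OF h] Pint])
    fix x
    \<comment> \<open>Near antisymmetry of \<open>f\<close> along edges becomes near invariance of
      \<open>h\<close>.\<close>
    have "(\<bar>a\<bar> - \<bar>b\<bar>)\<^sup>2 \<le> (a + b)\<^sup>2" for a b :: real
      by (simp add: abs_le_square_iff[symmetric])
    then show "nsum (\<lambda>p. (h (fst p) - h (snd p))\<^sup>2) x \<le> ?P x"
      by (simp add: nsum_def h_def sum_mono)
  qed
  then have "L2_ip M (real d *\<^sub>R h - T h) h \<le> \<delta>" using energy energy_diff(2)[OF h] by simp
  then have var: "(\<integral>x. (h x - m)\<^sup>2 \<partial>M) \<le> C * \<delta>"
    using C(2)[OF h] C(1) unfolding m_def by (meson mult_left_mono order_trans)
  have hi: "integrable M h" using real_L2_mult_integrable[OF h, of "\<lambda>_. 1"] by (simp add: real_L2_def)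
  have h2: "integrable M (\<lambda>x. (h x)\<^sup>2)" using h by (rule real_L2D)
  have vi: "integrable M (\<lambda>x. (h x - m)\<^sup>2)"
    using hi h2 by (simp add: power2_diff)
  have "(\<integral>x. (h x - m)\<^sup>2 \<partial>M) = 1 - m\<^sup>2"
  proof -
    have "(\<integral>x. (h x - m)\<^sup>2 \<partial>M) = (\<integral>x. (h x)\<^sup>2 \<partial>M) + m\<^sup>2 - 2 * m * m"
      using hi h2 by (simp add: power2_diff prob_space m_def mult.commute)
    then show ?thesis using f1 by (simp add: h_def power2_eq_square)
  qed
  then have "3/4 \<le> m\<^sup>2" using var \<delta>(2) by linarith
  moreover have "0 \<le> m" unfolding m_def by (intro integral_nonneg_AE) (simp add: h_def)
  \<comment> \<open>Otherwise \<open>m\<^sup>2\<close> would be at most 9/16, less than 3/4.\<close>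
  ultimately have m: "m \<ge> 3/4"
    using power_mono[of m "3/4" 2] by (cases "m \<ge> 3/4") (auto simp: power2_eq_square)
  have markov: "measure M {x. a \<le> w x} \<le> (\<integral>x. w x \<partial>M) / a"
    if "integrable M w" "\<And>x. 0 \<le> w x" "a > 0" for w :: "'a \<Rightarrow> real" and a
    using integral_Markov_inequality_measure[of M w "{}" a] that by (simp add: space_M)
  \<comment> \<open>On \<open>R\<close> the function \<open>h\<close> is at least
    \<open>3/4 - 1/2 = 1/4\<close> away from its mean. An edge inside one sign class outside
    \<open>R\<close> contributes more than 1 to the sum \<open>?P\<close> at its ends in
    \<open>X\<close>, which puts them into \<open>B\<close>.\<close>
  define R where "R = {x. h x \<le> 1/2}"
  define B where "B = {x. 1 \<le> ?P x}"
  have Pm: "?P \<in> borel_measurable M" using Pint by (rule borel_measurable_integrable)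
  have RB: "R \<in> sets M" "B \<in> sets M"
  proof -
    have "h -` {..1/2} \<inter> space M \<in> sets M" using hm by (rule measurable_sets) simp
    moreover have "h -` {..1/2} \<inter> space M = R" by (auto simp: R_def space_M)
    ultimately show "R \<in> sets M" by simp
    have "?P -` {1..} \<inter> space M \<in> sets M" using Pm by (rule measurable_sets) simp
    moreover have "?P -` {1..} \<inter> space M = B" by (auto simp: B_def space_M)
    ultimately show "B \<in> sets M" by simp
  qed
  have "R \<subseteq> {x. 1/16 \<le> (h x - m)\<^sup>2}"
  proof
    fix x assume "x \<in> R"
    then have "1/4 \<le> m - h x" using m by (simp add: R_def)
    then have "(1/4)\<^sup>2 \<le> (m - h x)\<^sup>2" by (intro power_mono) auto
    then show "x \<in> {x. 1/16 \<le> (h x - m)\<^sup>2}" by (simp add: power2_commute power_divide)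
  qed
  moreover have "{x. 1/16 \<le> (h x - m)\<^sup>2} \<in> sets M"
  proof -
    have "(\<lambda>x. (h x - m)\<^sup>2) -` {1/16..} \<inter> space M \<in> sets M"
      by (rule measurable_sets[of _ _ borel]) (use hm in auto)
    moreover have "(\<lambda>x. (h x - m)\<^sup>2) -` {1/16..} \<inter> space M = {x. 1/16 \<le> (h x - m)\<^sup>2}" by (auto simp: space_M)
    ultimately show ?thesis by simp
  qed
  ultimately have "measure M R \<le> measure M {x. 1/16 \<le> (h x - m)\<^sup>2}" by (rule finite_measure_mono)
  also have "\<dots> \<le> 16 * (C * \<delta>)" using markov[OF vi, of "1/16"] var by simp
  finally have mR: "measure M R \<le> 16 * (C * \<delta>)" .
  have "0 \<le> ?P x" for x by (rule nsum_nonneg) simp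
  then have mB: "measure M B \<le> 2 * \<delta>" using markov[OF Pint, of 1] energy by (simp add: B_def)
  have Xc: "measure M (- X) = 0"
  proof -
    have "- X \<in> null_sets M" using conull X_borel borel_comp[OF X_borel] by (subst AE_iff_null_sets) (auto simp: sets_M)
    then show ?thesis by (simp add: measure_eq_0_null_sets)
  qed
  define G where "G = X - R - B"
  have GM: "G \<in> sets M" using X RB by (auto simp: G_def)
  have "measure M (- G) \<le> measure M (- X) + measure M R + measure M B"
  proof -
    have sets: "- X \<in> sets M" using borel_comp[OF X_borel] by (simp add: sets_M)
    have "- G = - X \<union> R \<union> B" by (auto simp: G_def)
    then show ?thesis
      using measure_Un_le[of "- X \<union> R" M B] measure_Un_le[of "- X" M R] sets RB by auto
  qed
  also have "\<dots> < eps" using mR mB Xc \<delta> by (simp add: algebra_simps)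
  finally have mG: "measure M G > 1 - eps" using prob_compl[OF GM] by (simp add: space_M Compl_eq_Diff_UNIV)
  have bad: "\<not> E x y" if x: "x \<in> G" and s: "1 < \<bar>f x + f y\<bar>" for x y
  proof
    assume E: "E x y"
    have "(f x + f y)\<^sup>2 \<le> (\<Sum>y\<in>neighbours E x. (f x + f y)\<^sup>2)"
      by (rule member_le_sum) (use E x fin_nb in \<open>auto simp: neighbours_def G_def\<close>)
    also have "\<dots> = ?P x" using x by (simp add: nsum_def G_def)
    also have "\<dots> < 1" using x by (simp add: G_def B_def)
    finally show False using s abs_square_le_1[of "f x + f y"] by (simp add: abs_square_less_1)
  qed
  show "\<exists>A B. A \<in> sets M \<and> B \<in> sets M \<and> A \<inter> B = {} \<and> independent_set E A \<and> independent_set E B \<and>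
      1 - eps < measure M (A \<union> B)"
  proof (intro exI conjI)
    let ?A = "{x\<in>G. 1/2 < f x}" and ?B = "{x\<in>G. f x < - (1/2)}"
    have "?A = G \<inter> (f -` {1/2<..} \<inter> space M)" "?B = G \<inter> (f -` {..<-(1/2)} \<inter> space M)" by (auto simp: space_M)
    then show "?A \<in> sets M" "?B \<in> sets M" using GM fm by (auto intro!: sets.Int measurable_sets)
    show "?A \<inter> ?B = {}" by auto
    show "independent_set E ?A" "independent_set E ?B"
      unfolding independent_set_def using bad by auto
    have "?A \<union> ?B = G" by (auto simp: G_def R_def h_def)
    then show "1 - eps < measure M (?A \<union> ?B)" using mG by simp
  qed
qed

end

theorem theorem4p5:
  fixes M :: "'a::polish_space measure" and E :: "'a \<Rightarrow> 'a \<Rightarrow> bool" and d :: nat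
  assumes "standard_prob_space M"
    and "borel_graph M E"
    and "regular_graph M E d"
    and "pmp_graph M E"
    and "ergodic_graph M E"
    and "has_spectral_gap M E d"
    and "complex_of_real (- real d) \<in> adjacency_spectrum M E"
  shows "approx_measurably_bipartite M E"
proof -
  have sets_M: "sets M = sets borel" using assms(1) by (simp add: standard_prob_space_def)
  have space_M: "space M = UNIV" using sets_eq_imp_space_eq[OF sets_M] by simp
  have Eb: "{(x, y). E x y} \<in> sets borel"
    using assms(2) sets_pair_standard[OF sets_M] by (simp add: borel_graph_def)
  obtain N where "{x \<in> space M. \<not> (finite (neighbours E x) \<and> card (neighbours E x) = d)} \<subseteq> N"
    "emeasure M N = 0" "N \<in> sets M"
    using assms(3) unfolding regular_graph_def by (rule AE_E)
  then have N: "N \<in> null_sets M"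
    "{x \<in> space M. \<not> (finite (neighbours E x) \<and> card (neighbours E x) = d)} \<subseteq> N"
    by auto
  have reg: "finite (neighbours E x) \<and> card (neighbours E x) = d" if "x \<notin> N" for x
    using N(2) that by (auto simp: space_M)
  \<comment> \<open>The gap leaves no spectrum above \<open>d\<close>; the null set argument uses
    the value \<open>d + 1\<close>.\<close>
  have spec: "complex_of_real (real d + 1) \<notin> adjacency_spectrum M E"
  proof
    assume *: "complex_of_real (real d + 1) \<in> adjacency_spectrum M E"
    obtain e where "e > 0" "adjacency_spectrum M E \<subseteq>
       {complex_of_real t | t. - real d \<le> t \<and> t \<le> real d - e} \<union> {complex_of_real (real d)}"
      using assms(6) by (auto simp: has_spectral_gap_def)
    with * consider t where "complex_of_real (real d + 1) = complex_of_real t" "t \<le> real d - e"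
      | "complex_of_real (real d + 1) = complex_of_real (real d)" by blast
    then show False by cases (use \<open>e > 0\<close> in \<open>auto simp only: of_real_eq_iff\<close>)
  qed
  \<comment> \<open>The exceptional set of regularity is enlarged until no edge enters it from
    outside; its complement serves as \<open>X\<close>.\<close>
  obtain Z where Z: "Z \<in> null_sets M" "N \<subseteq> Z" "\<And>x y. x \<notin> Z \<Longrightarrow> E x y \<Longrightarrow> y \<notin> Z"
    by (rule null_sets_edge_closure[OF assms(1) Eb N(1) _ spec]) (use reg in auto)
  interpret conull_regular_graph M E d "- Z"
  proof
    show "- Z \<in> sets M" using null_setsD2[OF Z(1)] unfolding sets_M by (rule borel_comp)
    show "AE x in M. x \<in> - Z" using AE_not_in[OF Z(1)] by simp
  qed (use assms Z reg in auto)
  show ?thesis by (rule approx_bipartite[OF assms(5-7)])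
qed

end
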